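(* Let $X\prec T$ be a block subspace of Tsirelson's space $T$ and let $|\cdot|$ be any equivalent norm on $X$. Then $(X,|\cdot|)$ is asymptotic $\ell_1$ with constant at least $\sqrt2$.
   Context: Tsirelson's space $T$ is the completion of $c_{00}$ (finitely supported real sequences) under the norm satisfying $\|x\|=\max\big(\|x\|_\infty,\ \sup\{\frac12\sum_{i=1}^n\|E_ix\|:n\in\mathbb N,\ n\le E_1<\dots<E_n\}\big)$, where the $E_i$ are finite subsets of $\mathbb N$ ($E<F$ means $\max E<\min F$ or one is empty; $n\le E$ means $n\le\min E$) and $E_ix$ is the restriction of $x$ to $E_i$; $(e_i)$ is its unit vector basis. $X\prec T$ means that $X$ is the closed linear span of an infinite block basis $(x_i)$ of $(e_i)$, which is then taken as the basis of $X$. A space $X$ with norm $|\cdot|$ and basis $(x_i)$ is asymptotic $\ell_1$ (w.r.t. $(x_i)$) if there is $C$ such that for all $n$ and all finitely supported vectors $x_n\le y_1<\dots<y_n$ (supports w.r.t. $(x_i)$ are successive and $n\le\min\operatorname{supp}y_1$), $|\sum_1^ny_i|\ge(1/C)\sum_1^n|y_i|$. The infimum of all such $C$ is the asymptotic $\ell_1$ constant. *)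

theory Defs
  imports "HOL-Analysis.Analysis" "HOL-Analysis.Finite_Function_Topology"
begin

section \<open>Finitely supported sequences\<close>

text \<open>All sequences are indexed by the positive integers; index 0 of the type \<^typ>\<open>nat\<close> is unused.
  Only the vector space structure of \<^typ>\<open>nat \<Rightarrow>\<^sub>0 real\<close> is used, not the norm it carries
  in the library (the sum of the absolute values of the coefficients).\<close>

definition c00 :: "(nat \<Rightarrow>\<^sub>0 real) set" where
  "c00 = {a. 0 \<notin> Poly_Mapping.keys a}"

definition restr :: "nat set \<Rightarrow> (nat \<Rightarrow>\<^sub>0 real) \<Rightarrow> (nat \<Rightarrow>\<^sub>0 real)" where
  "restr E a = (\<Sum>j\<in>E. Poly_Mapping.single j (Poly_Mapping.lookup a j))"

definition lincomb :: "(nat \<Rightarrow> 'a::real_vector) \<Rightarrow> (nat \<Rightarrow>\<^sub>0 real) \<Rightarrow> 'a" where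
  "lincomb x a = (\<Sum>j\<in>Poly_Mapping.keys a. Poly_Mapping.lookup a j *\<^sub>R x j)"

definition norm_on :: "'a::real_vector set \<Rightarrow> ('a \<Rightarrow> real) \<Rightarrow> bool" where
  "norm_on S p \<longleftrightarrow> subspace S \<and>
     (\<forall>v\<in>S. 0 \<le> p v \<and> (p v = 0 \<longleftrightarrow> v = 0)) \<and>
     (\<forall>v\<in>S. \<forall>c. p (c *\<^sub>R v) = \<bar>c\<bar> * p v) \<and>
     (\<forall>v\<in>S. \<forall>w\<in>S. p (v + w) \<le> p v + p w)"

definition set_less :: "nat set \<Rightarrow> nat set \<Rightarrow> bool" where
  "set_less E F \<longleftrightarrow> (\<forall>a\<in>E. \<forall>b\<in>F. a < b)"

text \<open>The relation \<open>n \<le> E\<^sub>1 < \<dots> < E\<^sub>n\<close>. Since \<^const>\<open>set_less\<close> is vacuous when one of the sets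
  is empty, the chain is read as \<open>n \<le> E\<^sub>i\<close> for all \<open>i\<close> and \<open>E\<^sub>i < E\<^sub>j\<close> for all \<open>i < j\<close>.\<close>

definition admissible :: "nat \<Rightarrow> (nat \<Rightarrow> nat set) \<Rightarrow> bool" where
  "admissible n E \<longleftrightarrow>
     (\<forall>i\<in>{1..n}. finite (E i) \<and> (\<forall>k\<in>E i. n \<le> k)) \<and>
     (\<forall>i\<in>{1..n}. \<forall>j\<in>{1..n}. i < j \<longrightarrow> set_less (E i) (E j))"


section \<open>Tsirelson's space\<close>

text \<open>For \<open>N\<close> a norm on \<^const>\<open>c00\<close> the suprema below are over nonempty bounded sets. There is such
  an \<open>N\<close>, and its values on \<^const>\<open>c00\<close> are uniquely determined: see the lemmas
  \<open>tsirelson_norm_exists\<close> and \<open>tsirelson_norm_unique\<close>.\<close>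

definition tsirelson_sums :: "((nat \<Rightarrow>\<^sub>0 real) \<Rightarrow> real) \<Rightarrow> (nat \<Rightarrow>\<^sub>0 real) \<Rightarrow> real set" where
  "tsirelson_sums N a =
     {(1/2) * (\<Sum>i=1..n. N (restr (E i) a)) | n E. 1 \<le> n \<and> admissible n E}"

definition tsirelson_norm :: "((nat \<Rightarrow>\<^sub>0 real) \<Rightarrow> real) \<Rightarrow> bool" where
  "tsirelson_norm N \<longleftrightarrow> norm_on c00 N \<and>
     (\<forall>a\<in>c00. N a = max (SUP j. \<bar>Poly_Mapping.lookup a j\<bar>) (Sup (tsirelson_sums N a)))"


subsection \<open>Existence and uniqueness of the norm\<close>

lemma lookup_restr:
  "finite E \<Longrightarrow> Poly_Mapping.lookup (restr E a) j = (if j \<in> E then Poly_Mapping.lookup a j else 0)"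
  by (induction E rule: finite_induct) (auto simp: restr_def lookup_add lookup_single when_def)

lemma keys_restr: "finite E \<Longrightarrow> Poly_Mapping.keys (restr E a) = Poly_Mapping.keys a \<inter> E"
  by (auto simp: lookup_restr in_keys_iff split: if_splits)

lemma restr_in_c00: "finite E \<Longrightarrow> a \<in> c00 \<Longrightarrow> restr E a \<in> c00"
  by (simp add: c00_def keys_restr)

lemma lookup_scaleR:
  "Poly_Mapping.lookup (c *\<^sub>R a) j = c * Poly_Mapping.lookup (a :: nat \<Rightarrow>\<^sub>0 real) j"
proof -
  have "finite {i. c *\<^sub>R Poly_Mapping.lookup a i \<noteq> 0}"
    by (rule finite_subset[of _ "Poly_Mapping.keys a"]) (auto simp: in_keys_iff)
  then show ?thesis by (simp add: scaleR_poly_mapping_def)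
qed

lemma subspace_c00: "subspace c00"
  by (auto simp: subspace_def c00_def in_keys_iff lookup_add lookup_scaleR)

lemma admissible_disjoint:
  assumes "admissible n E" "i \<in> {1..n}" "j \<in> {1..n}" "i \<noteq> j"
  shows "E i \<inter> E j = {}"
proof -
  have less: "\<forall>a\<in>E k. \<forall>b\<in>E l. a < b" if "k \<in> {1..n}" "l \<in> {1..n}" "k < l" for k l
    using assms(1) that unfolding admissible_def set_less_def by blast
  have "i < j \<or> j < i" using assms(4) by auto
  then show ?thesis using less[OF assms(2,3)] less[OF assms(3,2)] by fastforce
qed

lemma tsirelson_sums_nonempty: "tsirelson_sums N a \<noteq> {}"
proof -
  have "1 \<le> (1::nat) \<and> admissible 1 (\<lambda>_. {})" by (simp add: admissible_def)
  then have "\<exists>s n E. s = (1/2) * (\<Sum>i=1..n. N (restr (E i) a)) \<and> 1 \<le> n \<and> admissible n E"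
    by blast
  then show ?thesis unfolding tsirelson_sums_def by blast
qed

lemma bdd_above_abs_lookup: "bdd_above (range (\<lambda>j. \<bar>Poly_Mapping.lookup (a :: nat \<Rightarrow>\<^sub>0 real) j\<bar>))"
proof -
  have "range (\<lambda>j. \<bar>Poly_Mapping.lookup a j\<bar>) \<subseteq>
          insert 0 ((\<lambda>j. \<bar>Poly_Mapping.lookup a j\<bar>) ` Poly_Mapping.keys a)"
    by (auto simp: in_keys_iff)
  then have "finite (range (\<lambda>j. \<bar>Poly_Mapping.lookup a j\<bar>))"
    by (rule finite_subset) simp
  then show ?thesis by (rule bdd_above_finite)
qed

lemma abs_lookup_le_SUP:
  "\<bar>Poly_Mapping.lookup (a :: nat \<Rightarrow>\<^sub>0 real) j\<bar> \<le> (SUP j. \<bar>Poly_Mapping.lookup a j\<bar>)"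
  by (rule cSUP_upper) (simp_all add: bdd_above_abs_lookup)

lemma norm_on_c00_bound:
  assumes "norm_on c00 N" "a \<in> c00"
  shows "N a \<le> (\<Sum>j\<in>Poly_Mapping.keys a. \<bar>Poly_Mapping.lookup a j\<bar> * N (Poly_Mapping.single j 1))"
proof -
  have eq: "a = (\<Sum>j\<in>Poly_Mapping.keys a. Poly_Mapping.lookup a j *\<^sub>R Poly_Mapping.single j 1)"
    by (rule poly_mapping_eqI)
       (simp add: lookup_sum lookup_scaleR lookup_single when_def if_distrib[of "(*) _"] in_keys_iff cong: if_cong)
  have "A \<subseteq> {1..} \<Longrightarrow> finite A \<Longrightarrow>
      N (\<Sum>j\<in>A. c j *\<^sub>R Poly_Mapping.single j 1) \<le> (\<Sum>j\<in>A. \<bar>c j\<bar> * N (Poly_Mapping.single j 1))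
       \<and> (\<Sum>j\<in>A. c j *\<^sub>R Poly_Mapping.single j 1) \<in> c00" for A and c :: "nat \<Rightarrow> real"
  proof (induction A rule: infinite_finite_induct)
    case (insert x A)
    have x: "Poly_Mapping.single x 1 \<in> c00" using insert.prems by (auto simp: c00_def)
    then have x': "c x *\<^sub>R Poly_Mapping.single x 1 \<in> c00"
      using subspace_c00 by (rule subspace_scale[rotated])
    let ?s = "\<Sum>j\<in>A. c j *\<^sub>R Poly_Mapping.single j (1::real)"
    have IH: "N ?s \<le> (\<Sum>j\<in>A. \<bar>c j\<bar> * N (Poly_Mapping.single j 1))" "?s \<in> c00" using insert by auto
    have "N (c x *\<^sub>R Poly_Mapping.single x 1 + ?s) \<le> N (c x *\<^sub>R Poly_Mapping.single x 1) + N ?s"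
      using assms(1) x' IH(2) by (simp add: norm_on_def)
    moreover have "N (c x *\<^sub>R Poly_Mapping.single x 1) = \<bar>c x\<bar> * N (Poly_Mapping.single x 1)"
      using assms(1) x by (simp add: norm_on_def)
    ultimately show ?case
      using insert.hyps IH subspace_add[OF subspace_c00 x' IH(2)] by simp
  qed (use assms(1) subspace_0[OF subspace_c00] in \<open>auto simp: norm_on_def\<close>)
  note bound = this[of "Poly_Mapping.keys a" "Poly_Mapping.lookup a"]
  have "Poly_Mapping.keys a \<subseteq> {1..}"
  proof
    fix j assume "j \<in> Poly_Mapping.keys a"
    then show "j \<in> {1..}" using assms(2) by (cases j) (auto simp: c00_def)
  qed
  then show ?thesis using bound unfolding eq[symmetric] by simp
qed

lemma bdd_above_tsirelson_sums:
  assumes "norm_on c00 N" "a \<in> c00"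
  shows "bdd_above (tsirelson_sums N a)"
proof -
  define w where "w j = \<bar>Poly_Mapping.lookup a j\<bar> * N (Poly_Mapping.single j 1)" for j
  have w0: "0 \<le> w j" if "j \<in> Poly_Mapping.keys a" for j
  proof -
    have "Poly_Mapping.single j (1::real) \<in> c00"
      using that assms(2) by (cases "j = 0") (auto simp: c00_def)
    then show ?thesis using assms(1) by (auto simp: w_def norm_on_def)
  qed
  have "(1/2) * (\<Sum>i=1..n. N (restr (E i) a)) \<le> sum w (Poly_Mapping.keys a)"
    if E: "admissible n E" for n E
  proof -
    have fin: "finite (E i)" if "i \<in> {1..n}" for i using E that by (auto simp: admissible_def)
    have "(\<Sum>i=1..n. N (restr (E i) a)) \<le> (\<Sum>i=1..n. sum w (Poly_Mapping.keys a \<inter> E i))"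
    proof (rule sum_mono)
      fix i assume i: "i \<in> {1..n}"
      have "N (restr (E i) a) \<le> (\<Sum>j\<in>Poly_Mapping.keys (restr (E i) a).
          \<bar>Poly_Mapping.lookup (restr (E i) a) j\<bar> * N (Poly_Mapping.single j 1))"
        using norm_on_c00_bound[OF assms(1)] restr_in_c00[OF fin[OF i] assms(2)] by blast
      also have "\<dots> = sum w (Poly_Mapping.keys a \<inter> E i)"
        unfolding keys_restr[OF fin[OF i]] w_def
        by (rule sum.cong) (auto simp: lookup_restr[OF fin[OF i]])
      finally show "N (restr (E i) a) \<le> sum w (Poly_Mapping.keys a \<inter> E i)" .
    qed
    also have "\<dots> = sum w (\<Union>i\<in>{1..n}. Poly_Mapping.keys a \<inter> E i)"
    proof (rule sum.UNION_disjoint[symmetric])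
      show "\<forall>i\<in>{1..n}. \<forall>j\<in>{1..n}. i \<noteq> j \<longrightarrow>
          (Poly_Mapping.keys a \<inter> E i) \<inter> (Poly_Mapping.keys a \<inter> E j) = {}"
        using admissible_disjoint[OF E] by blast
    qed auto
    also have "\<dots> \<le> sum w (Poly_Mapping.keys a)"
      by (rule sum_mono2) (use w0 in auto)
    finally show ?thesis using sum_nonneg[of "Poly_Mapping.keys a" w] w0 by simp
  qed
  then show ?thesis unfolding tsirelson_sums_def by (intro bdd_aboveI) blast
qed

lemma tsirelson_norm_le:
  assumes "tsirelson_norm N" "tsirelson_norm M" "a \<in> c00"
  shows "N a \<le> M a"
  using assms(3)
proof (induction "card (Poly_Mapping.keys a)" arbitrary: a rule: less_induct)
  case less
  have nN: "norm_on c00 N" and nM: "norm_on c00 M"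
    using assms(1,2) by (auto simp: tsirelson_norm_def)
  have N: "N a = max (SUP j. \<bar>Poly_Mapping.lookup a j\<bar>) (Sup (tsirelson_sums N a))"
    and M: "M a = max (SUP j. \<bar>Poly_Mapping.lookup a j\<bar>) (Sup (tsirelson_sums M a))"
    using assms(1,2) less.prems by (auto simp: tsirelson_norm_def)
  have M0: "0 \<le> M a" and N0: "N 0 = 0" 
    using nM nN less.prems subspace_0[OF subspace_c00] by (auto simp: norm_on_def)
  have "s \<le> max (M a) (N a / 2)" if "s \<in> tsirelson_sums N a" for s
  proof -
    obtain n E where n: "1 \<le> n" and E: "admissible n E"
      and s: "s = (1/2) * (\<Sum>i=1..n. N (restr (E i) a))"
      using \<open>s \<in> tsirelson_sums N a\<close> unfolding tsirelson_sums_def by blast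
    have fin: "finite (E i)" if "i \<in> {1..n}" for i using E that by (auto simp: admissible_def)
    show ?thesis
    proof (cases "\<exists>i\<in>{1..n}. Poly_Mapping.keys a \<subseteq> E i")
      case True
      then obtain i where i: "i \<in> {1..n}" "Poly_Mapping.keys a \<subseteq> E i" by blast
      have "restr (E i) a = a"
        by (rule poly_mapping_eqI) (use i in \<open>auto simp: lookup_restr[OF fin] in_keys_iff\<close>)
      moreover have "restr (E j) a = 0" if j: "j \<in> {1..n} - {i}" for j
      proof -
        have "E i \<inter> E j = {}" using admissible_disjoint[OF E] i j by blast
        then have "Poly_Mapping.keys (restr (E j) a) = {}"
          using i j keys_restr[OF fin] by blast
        then show ?thesis by simp
      qed
      ultimately have "(\<Sum>i=1..n. N (restr (E i) a)) = N a"
        using i N0 by (subst sum.remove[of _ i]) auto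
      then show ?thesis using s by simp
    next
      case False
      have "N (restr (E i) a) \<le> M (restr (E i) a)" if i: "i \<in> {1..n}" for i
      proof (rule less.hyps)
        show "card (Poly_Mapping.keys (restr (E i) a)) < card (Poly_Mapping.keys a)"
          using False i unfolding keys_restr[OF fin[OF i]] by (intro psubset_card_mono) auto
        show "restr (E i) a \<in> c00" using fin i less.prems by (simp add: restr_in_c00)
      qed
      then have "(\<Sum>i=1..n. N (restr (E i) a)) \<le> (\<Sum>i=1..n. M (restr (E i) a))"
        by (rule sum_mono)
      then have "s \<le> (1/2) * (\<Sum>i=1..n. M (restr (E i) a))"
        unfolding s by simp
      also have "\<dots> \<le> Sup (tsirelson_sums M a)"
        using n E bdd_above_tsirelson_sums[OF nM less.prems]
        by (intro cSup_upper) (auto simp: tsirelson_sums_def)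
      also have "\<dots> \<le> M a" using M by simp
      finally show ?thesis by simp
    qed
  qed
  then have "Sup (tsirelson_sums N a) \<le> max (M a) (N a / 2)"
    using tsirelson_sums_nonempty by (intro cSup_least) auto
  then show ?case using N M M0 by (auto simp: max_def split: if_splits)
qed

lemma tsirelson_norm_unique:
  "tsirelson_norm N \<Longrightarrow> tsirelson_norm M \<Longrightarrow> a \<in> c00 \<Longrightarrow> N a = M a"
  by (simp add: antisym tsirelson_norm_le)

text \<open>For existence, \<open>N a\<close> is the supremum of \<open>\<bar>f(a)\<bar>\<close> over the usual norming set of functionals \<open>f\<close>.\<close>

inductive_set norming :: "(nat \<Rightarrow> real) set" where
  zero: "(\<lambda>_. 0) \<in> norming"
| unit: "\<bar>c\<bar> = 1 \<Longrightarrow> (\<lambda>j. if j = i then c else 0) \<in> norming"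
| avg: "1 \<le> n \<Longrightarrow> admissible n E \<Longrightarrow> (\<And>i. i \<in> {1..n} \<Longrightarrow> F i \<in> norming) \<Longrightarrow>
    (\<And>i j. i \<in> {1..n} \<Longrightarrow> j \<notin> E i \<Longrightarrow> F i j = 0) \<Longrightarrow>
    (\<lambda>j. (1/2) * (\<Sum>i=1..n. F i j)) \<in> norming"

definition pair :: "(nat \<Rightarrow> real) \<Rightarrow> (nat \<Rightarrow>\<^sub>0 real) \<Rightarrow> real" where
  "pair f a = (\<Sum>j\<in>Poly_Mapping.keys a. f j * Poly_Mapping.lookup a j)"

lemma pair_superset:
  "finite S \<Longrightarrow> Poly_Mapping.keys a \<subseteq> S \<Longrightarrow> pair f a = (\<Sum>j\<in>S. f j * Poly_Mapping.lookup a j)"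
  unfolding pair_def by (rule sum.mono_neutral_left) (auto simp: in_keys_iff)

lemma pair_add: "pair f (a + b) = pair f a + pair f b"
proof -
  let ?S = "Poly_Mapping.keys a \<union> Poly_Mapping.keys b"
  have "finite ?S" "Poly_Mapping.keys (a + b) \<subseteq> ?S" by (auto simp: in_keys_iff lookup_add)
  then show ?thesis
    by (simp add: pair_superset[of ?S] lookup_add distrib_left sum.distrib)
qed

lemma pair_scaleR: "pair f (c *\<^sub>R a) = c * pair f a"
proof -
  have "Poly_Mapping.keys (c *\<^sub>R a) \<subseteq> Poly_Mapping.keys a" by (auto simp: in_keys_iff lookup_scaleR)
  then have "pair f (c *\<^sub>R a) = (\<Sum>j\<in>Poly_Mapping.keys a. f j * Poly_Mapping.lookup (c *\<^sub>R a) j)"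
    by (intro pair_superset) auto
  then show ?thesis by (simp add: pair_def lookup_scaleR sum_distrib_left ac_simps)
qed

lemma pair_avg: "pair (\<lambda>j. (1/2) * (\<Sum>i=1..n. F i j)) a = (1/2) * (\<Sum>i=1..n. pair (F i) a)"
  unfolding pair_def by (subst sum.swap) (simp add: sum_distrib_left sum_distrib_right ac_simps)

lemma pair_restr:
  "finite E \<Longrightarrow> pair f (restr E a) = pair (\<lambda>j. if j \<in> E then f j else 0) a"
  by (subst pair_superset[of "Poly_Mapping.keys a"])
     (auto simp: keys_restr lookup_restr pair_def intro!: sum.cong)

lemma norming_abs_le: "f \<in> norming \<Longrightarrow> \<bar>f j\<bar> \<le> 1"
proof (induction rule: norming.induct)
  case (avg n E F)
  have "\<bar>\<Sum>i=1..n. F i j\<bar> \<le> 1"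
  proof (cases "\<exists>i\<in>{1..n}. j \<in> E i")
    case True
    then obtain i where i: "i \<in> {1..n}" "j \<in> E i" by blast
    have "F k j = 0" if "k \<in> {1..n} - {i}" for k
      using that i avg.hyps(4) admissible_disjoint[OF avg.hyps(2), of i k] by blast
    then have "(\<Sum>i=1..n. F i j) = F i j" using i by (subst sum.remove[of _ i]) auto
    then show ?thesis using avg.IH i by simp
  next
    case False
    then have "F i j = 0" if "i \<in> {1..n}" for i using that avg.hyps(4) by blast
    then show ?thesis by simp
  qed
  then show ?case by simp
qed auto

lemma norming_uminus: "f \<in> norming \<Longrightarrow> (\<lambda>j. - f j) \<in> norming"
proof (induction rule: norming.induct)
  case zero then show ?case by (simp add: norming.zero)
next
  case (unit c i)
  then have "(\<lambda>j. if j = i then - c else 0) \<in> norming" by (intro norming.unit) simp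
  moreover have "(\<lambda>j. - (if j = i then c else 0)) = (\<lambda>j. if j = i then - c else 0)" by auto
  ultimately show ?case by simp
next
  case (avg n E F)
  have "(\<lambda>j. (1/2) * (\<Sum>i=1..n. - F i j)) \<in> norming"
    by (rule norming.avg[OF avg.hyps(1,2)]) (use avg in auto)
  then show ?case by (simp add: sum_negf)
qed

lemma norming_restr: "f \<in> norming \<Longrightarrow> (\<lambda>j. if j \<in> A then f j else 0) \<in> norming"
proof (induction rule: norming.induct)
  case zero then show ?case by (simp add: norming.zero)
next
  case (unit c i)
  have "(\<lambda>j. if j \<in> A then if j = i then c else 0 else 0)
      = (if i \<in> A then (\<lambda>j. if j = i then c else 0) else (\<lambda>_. 0))" by auto
  then show ?case using unit norming.unit norming.zero by simp
next
  case (avg n E F)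
  have "(\<lambda>j. (1/2) * (\<Sum>i=1..n. if j \<in> A then F i j else 0)) \<in> norming"
    by (rule norming.avg[OF avg.hyps(1,2)]) (use avg in auto)
  moreover have "(\<lambda>j. (1/2) * (\<Sum>i=1..n. if j \<in> A then F i j else 0))
      = (\<lambda>j. if j \<in> A then (1/2) * (\<Sum>i=1..n. F i j) else 0)" by auto
  ultimately show ?case by simp
qed

theorem tsirelson_norm_exists: "\<exists>N. tsirelson_norm N"
proof -
  define N where "N a = (SUP f\<in>norming. \<bar>pair f a\<bar>)" for a
  have ne: "norming \<noteq> {}" using norming.zero by blast
  have bound: "\<bar>pair f a\<bar> \<le> (\<Sum>j\<in>Poly_Mapping.keys a. \<bar>Poly_Mapping.lookup a j\<bar>)"
    if "f \<in> norming" for f a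
    unfolding pair_def
    by (rule order.trans[OF sum_abs], rule sum_mono)
       (use norming_abs_le[OF that] in \<open>auto simp: abs_mult intro: mult_left_le_one_le\<close>)
  then have bdd: "bdd_above ((\<lambda>f. \<bar>pair f a\<bar>) ` norming)" for a by (auto intro!: bdd_aboveI)
  have up: "\<bar>pair f a\<bar> \<le> N a" if "f \<in> norming" for f a
    unfolding N_def using that bdd by (rule cSUP_upper)
  have least: "N a \<le> r" if "\<And>f. f \<in> norming \<Longrightarrow> \<bar>pair f a\<bar> \<le> r" for a r
    unfolding N_def using ne that by (rule cSUP_least)
  have coord: "\<bar>Poly_Mapping.lookup a j\<bar> \<le> N a" for a j
  proof -
    have "pair (\<lambda>i. if i = j then 1 else 0) a = Poly_Mapping.lookup a j"
      by (subst pair_superset[of "insert j (Poly_Mapping.keys a)"])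
         (auto simp: if_distrib[of "\<lambda>c. c * _"] cong: if_cong)
    then show ?thesis using up[OF norming.unit[of 1 j], of a] by simp
  qed
  have nonneg: "0 \<le> N a" for a using coord[of a 0] by simp
  have zero: "N 0 = 0" using least[of 0 0] nonneg[of 0] by (simp add: pair_def)
  have scale_le: "N (c *\<^sub>R a) \<le> \<bar>c\<bar> * N a" for c a
    by (rule least) (simp add: pair_scaleR abs_mult mult_left_mono up)
  have scale: "N (c *\<^sub>R a) = \<bar>c\<bar> * N a" for c a
  proof (cases "c = 0")
    case False
    have "\<bar>c\<bar> * N a \<le> \<bar>c\<bar> * (\<bar>1/c\<bar> * N (c *\<^sub>R a))"
      using scale_le[of "1/c" "c *\<^sub>R a"] False by (intro mult_left_mono) auto
    then show ?thesis using scale_le[of c a] False by simp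
  qed (simp add: zero)
  have nrm: "norm_on c00 N"
    unfolding norm_on_def
  proof (intro conjI ballI allI)
    fix v w :: "nat \<Rightarrow>\<^sub>0 real"
    show "N (v + w) \<le> N v + N w"
    proof (rule least)
      fix f assume "f \<in> norming"
      then show "\<bar>pair f (v + w)\<bar> \<le> N v + N w"
        using up[of f v] up[of f w] unfolding pair_add by linarith
    qed
    show "(N v = 0) = (v = 0)"
    proof
      assume "N v = 0"
      then show "v = 0" using coord[of v] by (intro poly_mapping_eqI) simp
    qed (simp add: zero)
  qed (auto simp: subspace_c00 nonneg scale)
  have eq: "N a = max (SUP j. \<bar>Poly_Mapping.lookup a j\<bar>) (Sup (tsirelson_sums N a))" (is "_ = ?R")
    if a: "a \<in> c00" for a
  proof (rule antisym)
    have elem_le: "s \<le> N a" if "s \<in> tsirelson_sums N a" for s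
    proof -
      obtain n E where n: "1 \<le> n" and E: "admissible n E"
        and s: "s = (1/2) * (\<Sum>i=1..n. N (restr (E i) a))"
        using \<open>s \<in> tsirelson_sums N a\<close> unfolding tsirelson_sums_def by blast
      have fin: "finite (E i)" if "i \<in> {1..n}" for i using E that by (auto simp: admissible_def)
      show ?thesis
      proof (rule field_le_epsilon)
        fix \<epsilon> :: real assume "\<epsilon> > 0"
        define \<delta> where "\<delta> = \<epsilon> / n"
        have \<delta>: "\<delta> > 0" using \<open>\<epsilon> > 0\<close> n by (simp add: \<delta>_def)
        have "\<exists>f\<in>norming. pair f (restr (E i) a) \<ge> N (restr (E i) a) - \<delta>" for i
        proof -
          have "\<exists>f\<in>norming. \<bar>pair f (restr (E i) a)\<bar> > N (restr (E i) a) - \<delta>"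
          proof (rule ccontr)
            assume "\<not> ?thesis"
            then have "N (restr (E i) a) \<le> N (restr (E i) a) - \<delta>" by (intro least) (simp add: not_less)
            then show False using \<delta> by simp
          qed
          then obtain f where f: "f \<in> norming" "\<bar>pair f (restr (E i) a)\<bar> > N (restr (E i) a) - \<delta>"
            by blast
          have "pair (\<lambda>j. - f j) (restr (E i) a) = - pair f (restr (E i) a)"
            by (simp add: pair_def sum_negf)
          then show ?thesis using f norming_uminus[OF f(1)]
            by (cases "pair f (restr (E i) a) \<ge> 0") (auto intro: bexI[of _ f] bexI[of _ "\<lambda>j. - f j"])
        qed
        then obtain f where f: "\<And>i. f i \<in> norming"
          "\<And>i. pair (f i) (restr (E i) a) \<ge> N (restr (E i) a) - \<delta>"
          by (metis (no_types, lifting))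
        define F where "F i = (\<lambda>j. if j \<in> E i then f i j else 0)" for i
        have "(\<lambda>j. (1/2) * (\<Sum>i=1..n. F i j)) \<in> norming"
          by (rule norming.avg[OF n E]) (auto simp: F_def intro: norming_restr f(1))
        then have "(1/2) * (\<Sum>i=1..n. pair (F i) a) \<le> N a"
          using up[of "\<lambda>j. (1/2) * (\<Sum>i=1..n. F i j)" a] unfolding pair_avg by linarith
        moreover have "(\<Sum>i=1..n. N (restr (E i) a) - \<delta>) \<le> (\<Sum>i=1..n. pair (F i) a)"
        proof (rule sum_mono)
          fix i assume "i \<in> {1..n}"
          then show "N (restr (E i) a) - \<delta> \<le> pair (F i) a"
            using f(2)[of i] pair_restr[OF fin, of i "f i" a] by (simp add: F_def)
        qed
        moreover have "real n * \<delta> = \<epsilon>" using n by (simp add: \<delta>_def)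
        ultimately show "s \<le> N a + \<epsilon>"
          using s \<open>\<epsilon> > 0\<close> by (simp add: sum_subtractf)
      qed
    qed
    have "Sup (tsirelson_sums N a) \<le> N a"
      using tsirelson_sums_nonempty elem_le by (intro cSup_least) auto
    moreover have "(SUP j. \<bar>Poly_Mapping.lookup a j\<bar>) \<le> N a"
      using coord by (intro cSUP_least) auto
    ultimately show "?R \<le> N a" by simp
    show "N a \<le> ?R"
    proof (rule least)
      fix f assume "f \<in> norming"
      then show "\<bar>pair f a\<bar> \<le> ?R"
      proof cases
        case zero
        then have "pair f a = 0" by (simp add: pair_def)
        then show ?thesis
          using abs_ge_zero[of "Poly_Mapping.lookup a 0"] abs_lookup_le_SUP[of a 0] by linarith
      next
        case (unit c i)
        have "pair f a = c * Poly_Mapping.lookup a i"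
          unfolding unit(1)
          by (subst pair_superset[of "insert i (Poly_Mapping.keys a)"])
             (auto simp: if_distrib[of "\<lambda>c. c * _"] cong: if_cong)
        then show ?thesis using unit abs_lookup_le_SUP[of a i]
          by (simp add: abs_mult le_max_iff_disj)
      next
        case (avg n E F)
        have fin: "finite (E i)" if "i \<in> {1..n}" for i using avg that by (auto simp: admissible_def)
        have "\<bar>pair (F i) a\<bar> \<le> N (restr (E i) a)" if i: "i \<in> {1..n}" for i
        proof -
          have "(\<lambda>j. if j \<in> E i then F i j else 0) = F i" using avg(5)[OF i] by auto
          then have "pair (F i) (restr (E i) a) = pair (F i) a"
            using pair_restr[OF fin[OF i], of "F i" a] by simp
          then show ?thesis using up[OF avg(4)[OF i], of "restr (E i) a"] by simp
        qed
        then have "(\<Sum>i=1..n. \<bar>pair (F i) a\<bar>) \<le> (\<Sum>i=1..n. N (restr (E i) a))"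
          by (rule sum_mono)
        then have "\<bar>\<Sum>i=1..n. pair (F i) a\<bar> \<le> (\<Sum>i=1..n. N (restr (E i) a))"
          by (rule order.trans[OF sum_abs])
        then have "\<bar>pair f a\<bar> \<le> (1/2) * (\<Sum>i=1..n. N (restr (E i) a))"
          unfolding avg(1) pair_avg by simp
        also have "\<dots> \<le> Sup (tsirelson_sums N a)"
          using avg bdd_above_tsirelson_sums[OF nrm a]
          by (intro cSup_upper) (auto simp: tsirelson_sums_def)
        finally show ?thesis by simp
      qed
    qed
  qed
  show ?thesis using nrm eq unfolding tsirelson_norm_def by blast
qed

subsection \<open>The completion\<close>

text \<open>The type \<open>'a\<close> is a completion of \<^const>\<open>c00\<close> under \<open>N\<close>: the embedding sending the unit vectors
  to \<open>e 1, e 2, \<dots>\<close> is isometric with dense range.\<close>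

definition is_completion :: "((nat \<Rightarrow>\<^sub>0 real) \<Rightarrow> real) \<Rightarrow> (nat \<Rightarrow> 'a::banach) \<Rightarrow> bool" where
  "is_completion N e \<longleftrightarrow>
     (\<forall>a\<in>c00. norm (lincomb e a) = N a) \<and> closure (lincomb e ` c00) = UNIV"

definition tsirelson_space :: "(nat \<Rightarrow> 'a::banach) \<Rightarrow> bool" where
  "tsirelson_space e \<longleftrightarrow> (\<exists>N. tsirelson_norm N \<and> is_completion N e)"


section \<open>Block subspaces and equivalent norms\<close>

definition block_basis :: "(nat \<Rightarrow> 'a::real_vector) \<Rightarrow> (nat \<Rightarrow> 'a) \<Rightarrow> bool" where
  "block_basis e x \<longleftrightarrow> (\<exists>u.
     (\<forall>i\<ge>1. u i \<in> c00 \<and> u i \<noteq> 0 \<and> x i = lincomb e (u i)) \<and>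
     (\<forall>i\<ge>1. \<forall>j>i. set_less (Poly_Mapping.keys (u i)) (Poly_Mapping.keys (u j))))"

definition closed_span :: "(nat \<Rightarrow> 'a::real_normed_vector) \<Rightarrow> 'a set" where
  "closed_span x = closure (span (x ` {1..}))"

definition equivalent_norm_on :: "'a::real_normed_vector set \<Rightarrow> ('a \<Rightarrow> real) \<Rightarrow> bool" where
  "equivalent_norm_on S p \<longleftrightarrow> norm_on S p \<and>
     (\<exists>A>0. \<exists>B>0. \<forall>v\<in>S. A * norm v \<le> p v \<and> p v \<le> B * norm v)"


section \<open>Asymptotic l1 spaces\<close>

text \<open>The vectors \<open>y\<^sub>i\<close> are given by their coefficients \<open>b i\<close> with respect to the basis \<open>x\<close>. The
  condition \<open>C > 0\<close> is explicit because \<open>1 / C\<close> is \<open>0\<close> for \<open>C = 0\<close>.\<close>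

definition asymptotic_l1_with ::
    "real \<Rightarrow> (nat \<Rightarrow> 'a::real_vector) \<Rightarrow> ('a \<Rightarrow> real) \<Rightarrow> bool" where
  "asymptotic_l1_with C x p \<longleftrightarrow> C > 0 \<and>
     (\<forall>n\<ge>1. \<forall>b. (\<forall>i\<in>{1..n}. b i \<in> c00) \<and> admissible n (\<lambda>i. Poly_Mapping.keys (b i)) \<longrightarrow>
        p (\<Sum>i=1..n. lincomb x (b i)) \<ge> (1 / C) * (\<Sum>i=1..n. p (lincomb x (b i))))"

definition asymptotic_l1 :: "(nat \<Rightarrow> 'a::real_vector) \<Rightarrow> ('a \<Rightarrow> real) \<Rightarrow> bool" where
  "asymptotic_l1 x p \<longleftrightarrow> (\<exists>C. asymptotic_l1_with C x p)"

definition asymptotic_l1_constant :: "(nat \<Rightarrow> 'a::real_vector) \<Rightarrow> ('a \<Rightarrow> real) \<Rightarrow> real" where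
  "asymptotic_l1_constant x p = Inf {C. asymptotic_l1_with C x p}"

end

theory Submission
  imports Defs
begin

text \<open>Let \<open>\<beta>\<close> be (almost) the limit of the supremum of \<open>p v / norm v\<close> over the tails of \<open>X\<close>, and take
  successive blocks \<open>z\<^sub>j\<close> far out with \<open>norm z\<^sub>j = 1\<close> and \<open>p z\<^sub>j \<approx> \<beta>\<close>. Average \<open>n\<close> vectors that are
  themselves averages of rapidly increasing numbers of the \<open>z\<^sub>j\<close>. In the Tsirelson norm this
  iterated average has norm at most about \<open>1/2\<close>, so \<open>p\<close> is at most about \<open>\<beta> / 2\<close> there. Both
  layers of averaging are admissible with respect to \<open>x\<close>, so two applications of the lower
  \<open>l\<^sub>1\<close> estimate show that \<open>p\<close> is at least \<open>\<beta> / C\<^sup>2\<close>. Hence \<open>C\<^sup>2 \<ge> 2\<close>.\<close>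

section \<open>Linear combinations, supports, restrictions and norms\<close>

lemma lincomb_superset:
  assumes "finite S" "Poly_Mapping.keys a \<subseteq> S"
  shows "lincomb x a = (\<Sum>j\<in>S. Poly_Mapping.lookup a j *\<^sub>R x j)"
  unfolding lincomb_def by (rule sum.mono_neutral_left) (use assms in \<open>auto simp: in_keys_iff\<close>)

lemma linear_lincomb: "linear (lincomb x)"
proof (rule linearI)
  fix a b :: "nat \<Rightarrow>\<^sub>0 real" and c :: real
  let ?S = "Poly_Mapping.keys a \<union> Poly_Mapping.keys b"
  have "Poly_Mapping.keys (a + b) \<subseteq> ?S" by (auto simp: in_keys_iff lookup_add)
  then show "lincomb x (a + b) = lincomb x a + lincomb x b"
    by (simp add: lincomb_superset[of ?S] lookup_add scaleR_add_left sum.distrib)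
  have "Poly_Mapping.keys (c *\<^sub>R a) \<subseteq> Poly_Mapping.keys a"
    by (auto simp: in_keys_iff lookup_scaleR)
  then show "lincomb x (c *\<^sub>R a) = c *\<^sub>R lincomb x a"
    by (simp add: lincomb_superset[of "Poly_Mapping.keys a"] lookup_scaleR scaleR_sum_right)
qed

text \<open>Passage between bases: coefficients \<open>b\<close> with respect to the blocks
  \<open>x\<close> become coefficients \<open>lincomb u b\<close> with respect to \<open>e\<close>,
  where the Tsirelson norm is available.\<close>

lemma lincomb_lincomb:
  assumes "\<And>i. i \<in> Poly_Mapping.keys b \<Longrightarrow> x i = lincomb e (u i)"
  shows "lincomb e (lincomb u b) = lincomb x b"
  unfolding lincomb_def[of u] lincomb_def[of x]
  using assms by (simp add: linear_sum[OF linear_lincomb] linear_scale[OF linear_lincomb])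

lemma keys_scaleR_subset: "Poly_Mapping.keys (c *\<^sub>R a) \<subseteq> Poly_Mapping.keys (a :: nat \<Rightarrow>\<^sub>0 real)"
  by (auto simp: in_keys_iff lookup_scaleR)

lemma keys_sum_subset:
  "Poly_Mapping.keys (\<Sum>i\<in>I. f i :: nat \<Rightarrow>\<^sub>0 real) \<subseteq> (\<Union>i\<in>I. Poly_Mapping.keys (f i))"
proof
  fix k assume "k \<in> Poly_Mapping.keys (\<Sum>i\<in>I. f i)"
  then have "(\<Sum>i\<in>I. Poly_Mapping.lookup (f i) k) \<noteq> 0"
    by (simp add: in_keys_iff lookup_sum)
  then show "k \<in> (\<Union>i\<in>I. Poly_Mapping.keys (f i))"
    by (auto simp: in_keys_iff dest: sum.not_neutral_contains_not_neutral)
qed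

lemma keys_lincomb_subset:
  fixes u :: "nat \<Rightarrow> nat \<Rightarrow>\<^sub>0 real"
  shows
  "Poly_Mapping.keys (lincomb u b) \<subseteq> (\<Union>i\<in>Poly_Mapping.keys b. Poly_Mapping.keys (u i))"
  unfolding lincomb_def
  by (rule order.trans[OF keys_sum_subset]) (rule UN_mono[OF subset_refl keys_scaleR_subset])

lemma lincomb_in_c00:
  assumes "\<And>i. i \<in> Poly_Mapping.keys b \<Longrightarrow> u i \<in> c00"
  shows "lincomb u b \<in> c00"
  using assms keys_lincomb_subset[of u b] unfolding c00_def by blast

lemma lincomb_in_closed_span:
  assumes "b \<in> c00"
  shows "lincomb x b \<in> closed_span x"
proof -
  have "lincomb x b \<in> span (x ` {1..})"
    unfolding lincomb_def
  proof (intro span_sum span_scale span_base imageI)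
    fix j assume "j \<in> Poly_Mapping.keys b"
    then show "j \<in> {1..}" using assms by (cases j) (auto simp: c00_def)
  qed
  then show ?thesis unfolding closed_span_def using closure_subset by blast
qed

lemma linear_restr:
  assumes "finite E"
  shows "linear (restr E)"
  by (rule linearI) (auto intro!: poly_mapping_eqI simp: lookup_restr[OF assms] lookup_add lookup_scaleR)

lemma restr_superset: "finite E \<Longrightarrow> Poly_Mapping.keys a \<subseteq> E \<Longrightarrow> restr E a = a"
  by (rule poly_mapping_eqI) (auto simp: lookup_restr in_keys_iff)

lemma restr_disjoint: "finite E \<Longrightarrow> Poly_Mapping.keys a \<inter> E = {} \<Longrightarrow> restr E a = 0"
  by (rule poly_mapping_eqI) (auto simp: lookup_restr in_keys_iff)

lemma norm_on_zero: "norm_on S p \<Longrightarrow> p 0 = 0"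
  using subspace_0 unfolding norm_on_def by blast

lemma norm_on_sum_le:
  assumes "norm_on S p" "\<And>i. i \<in> I \<Longrightarrow> v i \<in> S"
  shows "p (\<Sum>i\<in>I. v i) \<le> (\<Sum>i\<in>I. p (v i))"
  using assms(2)
proof (induction I rule: infinite_finite_induct)
  case (insert i I)
  have "(\<Sum>i\<in>I. v i) \<in> S"
    using assms(1) insert.prems by (intro subspace_sum) (auto simp: norm_on_def)
  then have "p (v i + (\<Sum>i\<in>I. v i)) \<le> p (v i) + p (\<Sum>i\<in>I. v i)"
    using assms(1) insert.prems by (simp add: norm_on_def)
  then show ?case using insert by force
qed (simp_all add: norm_on_zero[OF assms(1)])

lemma norm_on_scaleR: "norm_on S p \<Longrightarrow> v \<in> S \<Longrightarrow> p (c *\<^sub>R v) = \<bar>c\<bar> * p v"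
  by (simp add: norm_on_def)

lemma norm_on_nonneg: "norm_on S p \<Longrightarrow> v \<in> S \<Longrightarrow> 0 \<le> p v"
  by (simp add: norm_on_def)


section \<open>Estimates for the Tsirelson norm\<close>

lemma tsirelson_norm_on: "tsirelson_norm N \<Longrightarrow> norm_on c00 N"
  by (simp add: tsirelson_norm_def)

lemma tsirelson_sum_le:
  assumes "tsirelson_norm N" "a \<in> c00" "1 \<le> n" "admissible n E"
  shows "(1/2) * (\<Sum>i=1..n. N (restr (E i) a)) \<le> N a"
proof -
  have "(1/2) * (\<Sum>i=1..n. N (restr (E i) a)) \<le> Sup (tsirelson_sums N a)"
    using assms bdd_above_tsirelson_sums[OF tsirelson_norm_on]
    by (intro cSup_upper) (auto simp: tsirelson_sums_def)
  then show ?thesis using assms(1,2) by (simp add: tsirelson_norm_def)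
qed

lemma tsirelson_abs_lookup_le:
  assumes "tsirelson_norm N" "a \<in> c00"
  shows "\<bar>Poly_Mapping.lookup a j\<bar> \<le> N a"
  using assms abs_lookup_le_SUP[of a j] by (simp add: tsirelson_norm_def)

lemma tsirelson_norm_leI:
  assumes "tsirelson_norm N" "a \<in> c00"
    and "\<And>j. \<bar>Poly_Mapping.lookup a j\<bar> \<le> r"
    and "\<And>n E. 1 \<le> n \<Longrightarrow> admissible n E \<Longrightarrow> (1/2) * (\<Sum>i=1..n. N (restr (E i) a)) \<le> r"
  shows "N a \<le> r"
proof -
  have "(SUP j. \<bar>Poly_Mapping.lookup a j\<bar>) \<le> r"
    using assms(3) by (intro cSUP_least) auto
  moreover have "Sup (tsirelson_sums N a) \<le> r"
  proof (rule cSup_least[OF tsirelson_sums_nonempty])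
    fix s assume "s \<in> tsirelson_sums N a"
    then show "s \<le> r" using assms(4) unfolding tsirelson_sums_def by blast
  qed
  ultimately show ?thesis using assms(1,2) by (simp add: tsirelson_norm_def)
qed

text \<open>Intersecting every set of an admissible family with \<open>E\<close> keeps it
  admissible, so each sum for the restriction is already a sum for \<open>a\<close>.\<close>

lemma tsirelson_restr_le:
  assumes N: "tsirelson_norm N" and a: "a \<in> c00" and fin: "finite E"
  shows "N (restr E a) \<le> N a"
proof (rule tsirelson_norm_leI[OF N restr_in_c00[OF fin a]])
  fix j
  show "\<bar>Poly_Mapping.lookup (restr E a) j\<bar> \<le> N a"
    using tsirelson_abs_lookup_le[OF N a, of j] by (auto simp: lookup_restr[OF fin])
next
  fix n F assume n: "1 \<le> n" and F: "admissible n F"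
  have "restr (F i) (restr E a) = restr (F i \<inter> E) a" if "i \<in> {1..n}" for i
    using F fin that
    by (intro poly_mapping_eqI) (auto simp: lookup_restr admissible_def)
  moreover have "admissible n (\<lambda>i. F i \<inter> E)"
    using F unfolding admissible_def set_less_def by blast
  ultimately show "(1/2) * (\<Sum>i=1..n. N (restr (F i) (restr E a))) \<le> N a"
    using tsirelson_sum_le[OF N a n, of "\<lambda>i. F i \<inter> E"] by simp
qed

text \<open>The supports of the \<open>a i\<close> serve as the sets of the norm formula; being
  disjoint, they recover each \<open>a i\<close> from the sum. The unit vector basis thus has
  asymptotic l1 constant at most 2.\<close>

lemma tsirelson_block_sum_ge:
  assumes N: "tsirelson_norm N" and n: "1 \<le> n" and a: "\<And>i. i \<in> {1..n} \<Longrightarrow> a i \<in> c00"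
    and adm: "admissible n (\<lambda>i. Poly_Mapping.keys (a i))"
  shows "(1/2) * (\<Sum>i=1..n. N (a i)) \<le> N (\<Sum>i=1..n. a i)"
proof -
  have "restr (Poly_Mapping.keys (a i)) (\<Sum>k=1..n. a k) = a i" if i: "i \<in> {1..n}" for i
  proof -
    have "restr (Poly_Mapping.keys (a i)) (a k) = 0" if "k \<in> {1..n} - {i}" for k
      using admissible_disjoint[OF adm, of k i] that i by (intro restr_disjoint) auto
    then show ?thesis
      using i by (subst linear_sum[OF linear_restr], simp, subst sum.remove[of _ i])
        (simp_all add: restr_superset)
  qed
  then show ?thesis
    using tsirelson_sum_le[OF N subspace_sum[OF subspace_c00] n adm, of "{1..n}" a] a by simp
qed

text \<open>A block vector is damped by the factor \<open>1/2\<close> unless it is split by the sets \<open>E\<^sub>l\<close>, and each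
  \<open>E\<^sub>l\<close> is the first set met by at most one split block.\<close>

lemma tsirelson_average_split_le:
  fixes a :: "nat \<Rightarrow> nat \<Rightarrow>\<^sub>0 real"
  assumes N: "tsirelson_norm N" and m: "1 \<le> m" and E: "admissible m E"
    and a: "\<And>j. a j \<in> c00" "\<And>j. N (a j) \<le> 1"
    and blocks: "\<And>i j. i < j \<Longrightarrow> set_less (Poly_Mapping.keys (a i)) (Poly_Mapping.keys (a j))"
    and J: "finite J"
  shows "(1/2) * (\<Sum>l=1..m. N (restr (E l) (\<Sum>j\<in>J. a j))) \<le> (1/2) * card J + (1/2) * m"
proof -
  have fin: "finite (E l)" if "l \<in> {1..m}" for l using E that by (auto simp: admissible_def)
  define met where "met j = {l \<in> {1..m}. Poly_Mapping.keys (a j) \<inter> E l \<noteq> {}}" for j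
  define V where "V j = (1/2) * (\<Sum>l=1..m. N (restr (E l) (a j)))" for j
  \<comment> \<open>These are the split blocks, whose supports meet at least two of the
    sets.\<close>
  define Sp where "Sp = {j \<in> J. 1 < card (met j)}"
  have finm: "finite (met j)" for j by (simp add: met_def)
  have V_met: "V j = (1/2) * (\<Sum>l\<in>met j. N (restr (E l) (a j)))" for j
    unfolding V_def
    by (subst sum.mono_neutral_right[of _ "met j"])
       (auto simp: met_def restr_disjoint fin norm_on_zero[OF tsirelson_norm_on[OF N]])
  \<comment> \<open>A split block is bounded only by its full norm, at most 1. An unsplit one
    contributes at most one nonzero term to the sum, and the factor 1/2 remains.\<close>
  have V: "V j \<le> 1/2 + (if j \<in> Sp then 1/2 else 0)" if j: "j \<in> J" for j
  proof (cases "j \<in> Sp")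
    case True
    then show ?thesis
      using tsirelson_sum_le[OF N a(1) m E, of j] a(2)[of j] by (simp add: V_def)
  next
    case False
    then have card: "card (met j) \<le> 1" using j by (simp add: Sp_def)
    have "N (restr (E l) (a j)) \<le> 1" if "l \<in> met j" for l
      using tsirelson_restr_le[OF N a(1) fin, of l j] a(2)[of j] that by (simp add: met_def)
    then have "(\<Sum>l\<in>met j. N (restr (E l) (a j))) \<le> of_nat (card (met j)) * 1"
      by (rule sum_bounded_above)
    then show ?thesis using card False unfolding V_met by simp
  qed
  \<comment> \<open>Let blocks \<open>i < j\<close> share a first set. Block \<open>i\<close> is
    split, so it also meets a later set \<open>E k\<close> at some \<open>s\<close>, while block
    \<open>j\<close> meets the shared set at some \<open>t\<close>. The order of the sets gives
    \<open>t < s\<close>, that of the blocks gives \<open>s < t\<close>.\<close>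
  have "inj_on (\<lambda>j. Min (met j)) Sp"
  proof (rule linorder_inj_onI')
    fix i j assume ij: "i \<in> Sp" "j \<in> Sp" "i < j"
    show "Min (met i) \<noteq> Min (met j)"
    proof
      assume eq: "Min (met i) = Min (met j)"
      have "met i \<noteq> {}" "met j \<noteq> {}" using ij by (auto simp: Sp_def)
      then have l: "Min (met i) \<in> met i" "Min (met j) \<in> met j" using finm by auto
      have "\<not> met i \<subseteq> {Min (met i)}"
        using ij card_mono[of "{Min (met i)}" "met i"] by (auto simp: Sp_def)
      then obtain k where k: "k \<in> met i" "k \<noteq> Min (met i)" by blast
      then have "Min (met i) < k" using Min_le[OF finm k(1)] by simp
      then have "set_less (E (Min (met i))) (E k)"
        using E k l by (auto simp: admissible_def met_def)
      moreover obtain s where "s \<in> Poly_Mapping.keys (a i)" "s \<in> E k"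
        using k by (auto simp: met_def)
      moreover obtain t where "t \<in> Poly_Mapping.keys (a j)" "t \<in> E (Min (met i))"
        using l unfolding eq by (auto simp: met_def)
      ultimately show False
        using blocks[OF ij(3)] unfolding set_less_def by fastforce
    qed
  qed
  moreover have "(\<lambda>j. Min (met j)) ` Sp \<subseteq> {1..m}"
  proof (rule image_subsetI)
    fix j assume "j \<in> Sp"
    then have "met j \<noteq> {}" by (auto simp: Sp_def)
    then have "Min (met j) \<in> met j" using finm by simp
    then show "Min (met j) \<in> {1..m}" by (simp add: met_def)
  qed
  ultimately have card_Sp: "card Sp \<le> m"
    using card_inj_on_le[of _ Sp "{1..m}"] by simp
  have "(\<Sum>l=1..m. N (restr (E l) (\<Sum>j\<in>J. a j))) \<le> (\<Sum>l=1..m. \<Sum>j\<in>J. N (restr (E l) (a j)))"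
    using norm_on_sum_le[OF tsirelson_norm_on[OF N], of J "\<lambda>j. restr (E _) (a j)"] a(1) fin
    by (intro sum_mono) (simp add: linear_sum[OF linear_restr] restr_in_c00)
  then have "(1/2) * (\<Sum>l=1..m. N (restr (E l) (\<Sum>j\<in>J. a j))) \<le> (\<Sum>j\<in>J. V j)"
    unfolding V_def sum_distrib_left[symmetric] by (subst sum.swap) simp
  also have "\<dots> \<le> (\<Sum>j\<in>J. 1/2 + (if j \<in> Sp then 1/2 else 0))"
    by (rule sum_mono) (rule V)
  also have "\<dots> = (1/2) * card J + (1/2) * card Sp"
    using J by (simp add: sum.distrib sum.If_cases Sp_def Int_def)
  also have "\<dots> \<le> (1/2) * card J + (1/2) * m" using card_Sp by simp
  finally show ?thesis .
qed

text \<open>If \<open>i0\<close> is the first inner average met by \<open>E\<^sub>1 < \<dots> < E\<^sub>m\<close>, then \<open>m\<close> is at most the end of its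
  support, which is negligible against the length \<open>s i\<close> of every later average; so all averages
  but \<open>i0\<close> are damped by almost \<open>1/2\<close>.\<close>

lemma tsirelson_iterated_average_le:
  fixes a :: "nat \<Rightarrow> nat \<Rightarrow>\<^sub>0 real" and s :: "nat \<Rightarrow> nat"
  assumes N: "tsirelson_norm N" and n: "1 \<le> n"
    and a: "\<And>j. a j \<in> c00" "\<And>j. N (a j) \<le> 1"
    and blocks: "\<And>i j. i < j \<Longrightarrow> set_less (Poly_Mapping.keys (a i)) (Poly_Mapping.keys (a j))"
    and s_pos: "\<And>i. 1 \<le> s i"
    and s_double: "\<And>i i'. i < i' \<Longrightarrow> 2 * s i \<le> s i'"
    and s_fast: "\<And>i i' j k. i < i' \<Longrightarrow> j \<le> 2 * s i \<Longrightarrow> k \<in> Poly_Mapping.keys (a j) \<Longrightarrow> n * k \<le> s i'"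
  shows "N (\<Sum>i=1..n. (1 / (n * s i)) *\<^sub>R (\<Sum>j\<in>{s i<..2 * s i}. a j)) \<le> 1/2 + 3 / (2 * n)"
proof -
  define z where "z i = (\<Sum>j\<in>{s i<..2 * s i}. a j)" for i
  define y where "y i = (1 / s i) *\<^sub>R z i" for i
  define x where "x = (1 / n) *\<^sub>R (\<Sum>i=1..n. y i)"
  have x_eq: "(\<Sum>i=1..n. (1 / (n * s i)) *\<^sub>R z i) = x"
    by (simp add: x_def y_def scaleR_sum_right)
  have z: "z i \<in> c00" for i unfolding z_def by (intro subspace_sum subspace_c00 a)
  have y: "y i \<in> c00" for i unfolding y_def by (intro subspace_scale subspace_c00 z)
  have x: "x \<in> c00" unfolding x_def by (intro subspace_scale subspace_sum subspace_c00 y)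
  have nrm: "norm_on c00 N" by (rule tsirelson_norm_on[OF N])
  have Ny: "N (y i) \<le> 1" for i
  proof -
    have "N (z i) \<le> (\<Sum>j\<in>{s i<..2 * s i}. N (a j))"
      unfolding z_def by (rule norm_on_sum_le[OF nrm a(1)])
    also have "\<dots> \<le> of_nat (card {s i<..2 * s i}) * 1" by (rule sum_bounded_above) (rule a(2))
    finally show ?thesis
      using s_pos[of i] by (simp add: y_def norm_on_scaleR[OF nrm z] divide_simps)
  qed
  have keys_y: "\<exists>j. s i < j \<and> j \<le> 2 * s i \<and> k \<in> Poly_Mapping.keys (a j)"
    if "k \<in> Poly_Mapping.keys (y i)" for i k
    using that keys_scaleR_subset keys_sum_subset[of a "{s i<..2 * s i}"] unfolding y_def z_def by fastforce
  have y_less: "set_less (Poly_Mapping.keys (y i)) (Poly_Mapping.keys (y i'))" if "i < i'" for i i'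
    unfolding set_less_def
  proof (intro ballI)
    fix k k' assume "k \<in> Poly_Mapping.keys (y i)" "k' \<in> Poly_Mapping.keys (y i')"
    then obtain j j' where j: "j \<le> 2 * s i" "k \<in> Poly_Mapping.keys (a j)"
      and j': "s i' < j'" "k' \<in> Poly_Mapping.keys (a j')"
      using keys_y by blast
    then have "j < j'" using s_double[OF that] by linarith
    then show "k < k'" using blocks j(2) j'(2) unfolding set_less_def by blast
  qed
  have "N x \<le> 1/2 + 3 / (2 * n)"
  proof (rule tsirelson_norm_leI[OF N x])
    fix k
    have "(\<Sum>i=1..n. \<bar>Poly_Mapping.lookup (y i) k\<bar>) \<le> 1"
    proof (cases "\<exists>i\<in>{1..n}. k \<in> Poly_Mapping.keys (y i)")
      case True
      then obtain i where i: "i \<in> {1..n}" "k \<in> Poly_Mapping.keys (y i)" by blast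
      have "Poly_Mapping.lookup (y i') k = 0" if "i' \<in> {1..n} - {i}" for i'
      proof -
        have "i < i' \<or> i' < i" using that by auto
        then have "k \<notin> Poly_Mapping.keys (y i')"
          using y_less[of i i'] y_less[of i' i] i(2) unfolding set_less_def by blast
        then show ?thesis by (simp add: in_keys_iff)
      qed
      then have "(\<Sum>i=1..n. \<bar>Poly_Mapping.lookup (y i) k\<bar>) = \<bar>Poly_Mapping.lookup (y i) k\<bar>"
        using i(1) by (subst sum.remove[of _ i]) auto
      also have "\<dots> \<le> 1" using tsirelson_abs_lookup_le[OF N y, of i k] Ny[of i] by linarith
      finally show ?thesis .
    next
      case False
      then have "(\<Sum>i=1..n. \<bar>Poly_Mapping.lookup (y i) k\<bar>) = 0"
        by (intro sum.neutral) (simp add: in_keys_iff)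
      then show ?thesis by simp
    qed
    then have "\<bar>\<Sum>i=1..n. Poly_Mapping.lookup (y i) k\<bar> \<le> 1"
      by (rule order.trans[OF sum_abs])
    then have "\<bar>Poly_Mapping.lookup x k\<bar> \<le> 1 / n"
      using n by (simp add: x_def lookup_scaleR lookup_sum abs_mult divide_simps)
    \<comment> \<open>The term 3/(2n) alone already dominates 1/n.\<close>
    also have "\<dots> \<le> 1/2 + 3 / (2 * n)" using n by (simp add: field_simps)
    finally show "\<bar>Poly_Mapping.lookup x k\<bar> \<le> 1/2 + 3 / (2 * n)" .
  next
    fix m E assume m: "1 \<le> m" and E: "admissible m E"
    have fin: "finite (E l)" if "l \<in> {1..m}" for l using E that by (auto simp: admissible_def)
    define W where "W i = (1/2) * (\<Sum>l=1..m. N (restr (E l) (y i)))" for i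
    \<comment> \<open>The damping factor of a late average: its \<open>s i\<close> blocks give at
      most \<open>s i / 2 + m / 2\<close> before division by \<open>s i\<close>, and
      \<open>m\<close> is at most \<open>s i / n\<close>.\<close>
    define r :: real where "r = 1/2 + 1 / (2 * n)"
    have r0: "0 \<le> r" by (simp add: r_def)
    have W1: "W i \<le> 1" for i
      using tsirelson_sum_le[OF N y m E, of i] Ny[of i] by (simp add: W_def)
    have W0: "W i = 0" if "\<And>l. l \<in> {1..m} \<Longrightarrow> Poly_Mapping.keys (y i) \<inter> E l = {}" for i
      using that by (simp add: W_def restr_disjoint fin norm_on_zero[OF nrm])
    have W_late: "W i \<le> r" if i0: "i0 < i" and l: "l \<in> {1..m}"
      and k: "k \<in> Poly_Mapping.keys (y i0)" "k \<in> E l" for i0 i l k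
    proof -
      have "m \<le> k" using E l k(2) by (auto simp: admissible_def)
      moreover obtain j where "j \<le> 2 * s i0" "k \<in> Poly_Mapping.keys (a j)"
        using keys_y[OF k(1)] by blast
      then have "n * k \<le> s i" using s_fast[OF i0] by blast
      ultimately have "n * m \<le> s i" using mult_le_mono2 order.trans by blast
      then have nm: "real n * real m \<le> real (s i)" by (metis of_nat_le_iff of_nat_mult)
      have "W i = (1 / s i) * ((1/2) * (\<Sum>l=1..m. N (restr (E l) (z i))))"
        unfolding W_def y_def
        by (simp add: linear_scale[OF linear_restr] fin norm_on_scaleR[OF nrm restr_in_c00] z
            flip: sum_divide_distrib)
      also have "\<dots> \<le> (1 / s i) * ((1/2) * card {s i<..2 * s i} + (1/2) * m)"
        unfolding z_def
        by (rule mult_left_mono[OF tsirelson_average_split_le[OF N m E a blocks]]) auto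
      also have "\<dots> \<le> r"
        using nm n s_pos[of i] by (simp add: r_def field_simps)
      finally show ?thesis .
    qed
    have "\<exists>i0. \<forall>i\<in>{1..n}. W i \<le> r + (if i = i0 then 1 else 0)"
    proof (cases "\<exists>i. \<exists>l\<in>{1..m}. Poly_Mapping.keys (y i) \<inter> E l \<noteq> {}")
      case True
      \<comment> \<open>The least index is taken over all naturals, so it may lie outside
        \<open>{1..n}\<close>; the bound with the exceptional term 1 at \<open>i0\<close> remains
        valid. Averages before \<open>i0\<close> contribute 0, and \<open>i0\<close> itself at most
        its norm.\<close>
      define i0 where "i0 = (LEAST i. \<exists>l\<in>{1..m}. Poly_Mapping.keys (y i) \<inter> E l \<noteq> {})"
      have "\<exists>l\<in>{1..m}. Poly_Mapping.keys (y i0) \<inter> E l \<noteq> {}"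
        unfolding i0_def using True by (rule LeastI_ex)
      then obtain l k where l: "l \<in> {1..m}" "k \<in> Poly_Mapping.keys (y i0)" "k \<in> E l" by blast
      have "W i \<le> r + (if i = i0 then 1 else 0)" for i
      proof (cases i i0 rule: linorder_cases)
        case less
        then have "W i = 0" using not_less_Least[of i] unfolding i0_def by (intro W0) blast
        then show ?thesis using r0 by simp
      next
        case equal
        then show ?thesis using W1[of i] r0 by simp
      next
        case greater
        then show ?thesis using W_late[OF greater l] by simp
      qed
      then show ?thesis by blast
    next
      case False
      then have "W i = 0" for i by (intro W0) blast
      then show ?thesis using r0 by simp
    qed
    then obtain i0 where i0: "\<And>i. i \<in> {1..n} \<Longrightarrow> W i \<le> r + (if i = i0 then 1 else 0)" by blast
    have "(\<Sum>i=1..n. W i) \<le> (\<Sum>i=1..n. r + (if i = i0 then 1 else 0))"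
      using i0 by (rule sum_mono)
    also have "\<dots> \<le> n * r + 1" by (simp add: sum.distrib)
    finally have W_sum: "(\<Sum>i=1..n. W i) \<le> n * r + 1" .
    have "N (restr (E l) x) \<le> (1 / n) * (\<Sum>i=1..n. N (restr (E l) (y i)))" if l: "l \<in> {1..m}" for l
    proof -
      have mem: "restr (E l) (y i) \<in> c00" for i using restr_in_c00[OF fin[OF l] y] .
      have "restr (E l) x = (1 / n) *\<^sub>R (\<Sum>i=1..n. restr (E l) (y i))"
        by (simp add: x_def linear_scale[OF linear_restr] linear_sum[OF linear_restr] fin[OF l])
      then have "N (restr (E l) x) = (1 / n) * N (\<Sum>i=1..n. restr (E l) (y i))"
        using norm_on_scaleR[OF nrm subspace_sum[OF subspace_c00 mem], of "1 / n" "\<lambda>i. i" "{1..n}"]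
        by simp
      also have "\<dots> \<le> (1 / n) * (\<Sum>i=1..n. N (restr (E l) (y i)))"
        by (rule mult_left_mono[OF norm_on_sum_le[OF nrm mem]]) simp
      finally show ?thesis .
    qed
    then have "(\<Sum>l=1..m. N (restr (E l) x)) \<le> (\<Sum>l=1..m. (1 / n) * (\<Sum>i=1..n. N (restr (E l) (y i))))"
      by (rule sum_mono)
    also have "\<dots> = (1 / n) * (2 * (\<Sum>i=1..n. W i))"
      unfolding W_def sum_distrib_left[symmetric] by (subst sum.swap) simp
    finally have "(1/2) * (\<Sum>l=1..m. N (restr (E l) x)) \<le> (1 / n) * (\<Sum>i=1..n. W i)"
      by (simp add: mult.commute)
    also have "\<dots> \<le> (1 / n) * (n * r + 1)" by (rule mult_left_mono[OF W_sum]) simp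
    \<comment> \<open>The excess over 1/2 is 1/(2n) from \<open>r\<close> plus 1/n from the one
      undamped average.\<close>
    also have "\<dots> = 1/2 + 3 / (2 * n)" using n by (simp add: r_def field_simps)
    finally show "(1/2) * (\<Sum>l=1..m. N (restr (E l) x)) \<le> 1/2 + 3 / (2 * n)" .
  qed
  then show ?thesis using x_eq unfolding z_def by simp
qed


section \<open>Choice of blocks\<close>

text \<open>\<open>Inf S\<close> is the best ratio bound of \<open>q\<close> by \<open>M\<close>
  that holds on some \<open>D m\<close>, and it is at least \<open>A\<close>, hence positive. So
  \<open>\<beta>\<close> can be chosen just below it with \<open>(1 + \<delta>) * \<beta>\<close>
  above it: the larger number is a bound on some \<open>D m0\<close>, whereas \<open>\<beta>\<close>
  fails on every \<open>D m\<close>.\<close>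

lemma near_maximal_ratio:
  fixes q M :: "'b \<Rightarrow> real" and D :: "nat \<Rightarrow> 'b set"
  assumes A: "0 < A" "\<And>m b. b \<in> D m \<Longrightarrow> A * M b \<le> q b"
    and B: "\<And>m b. b \<in> D m \<Longrightarrow> q b \<le> B * M b"
    and D: "\<And>m. \<exists>b\<in>D m. 0 < M b"
    and M: "\<And>m b. b \<in> D m \<Longrightarrow> 0 \<le> M b"
    and \<delta>: "0 < \<delta>"
  obtains \<beta> m0 where "0 < \<beta>" "\<And>b. b \<in> D m0 \<Longrightarrow> q b \<le> (1 + \<delta>) * \<beta> * M b"
    "\<And>m. \<exists>b\<in>D m. \<beta> * M b < q b"
proof -
  define S where "S = {\<beta>. \<exists>m. \<forall>b\<in>D m. q b \<le> \<beta> * M b}"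
  have S_ge: "A \<le> \<beta>" if \<beta>: "\<beta> \<in> S" for \<beta>
  proof -
    obtain m where m: "\<And>b. b \<in> D m \<Longrightarrow> q b \<le> \<beta> * M b" using \<beta> unfolding S_def by blast
    obtain b where b: "b \<in> D m" "0 < M b" using D by blast
    then have "A * M b \<le> \<beta> * M b" using A(2) m order.trans by blast
    then show ?thesis using b(2) by simp
  qed
  have ne: "S \<noteq> {}" using B by (auto simp: S_def)
  have bdd: "bdd_below S" using S_ge by (rule bdd_belowI)
  have pos: "0 < Inf S" using A(1) cInf_greatest[OF ne S_ge] by simp
  then have "Inf S / (1 + \<delta>) < Inf S" using \<delta> by (simp add: divide_less_eq)
  then obtain \<beta> where \<beta>: "Inf S / (1 + \<delta>) < \<beta>" "\<beta> < Inf S" using dense by blast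
  have "0 < Inf S / (1 + \<delta>)" using pos \<delta> by simp
  then have "0 < \<beta>" using \<beta>(1) by linarith
  have "Inf S < (1 + \<delta>) * \<beta>" using \<beta>(1) \<delta> by (simp add: divide_less_eq mult.commute)
  then obtain \<beta>1 where "\<beta>1 \<in> S" "\<beta>1 < (1 + \<delta>) * \<beta>" using cInf_lessD[OF ne] by blast
  then obtain m0 where m0: "\<And>b. b \<in> D m0 \<Longrightarrow> q b \<le> \<beta>1 * M b" unfolding S_def by blast
  show ?thesis
  proof (rule that[OF \<open>0 < \<beta>\<close>])
    fix b assume b: "b \<in> D m0"
    have "\<beta>1 * M b \<le> (1 + \<delta>) * \<beta> * M b"
      using M[OF b] \<open>\<beta>1 < _\<close> by (intro mult_right_mono) auto
    then show "q b \<le> (1 + \<delta>) * \<beta> * M b" using m0[OF b] by simp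
  next
    fix m
    have "\<beta> \<notin> S" using \<beta>(2) bdd cInf_lower by fastforce
    then show "\<exists>b\<in>D m. \<beta> * M b < q b" unfolding S_def by (auto simp: not_le)
  qed
qed

text \<open>Greedy choice. The explicit start \<open>m + j\<close> does more than keep the blocks
  far out: the \<open>s\<close> blocks with indices in \<open>{s<..2 * s}\<close> lie beyond
  \<open>s\<close>, as admissibility requires.\<close>

lemma exists_block_sequence:
  assumes "\<And>m. \<exists>b. Poly_Mapping.keys (b :: nat \<Rightarrow>\<^sub>0 real) \<subseteq> {m..} \<and> P b"
  obtains z :: "nat \<Rightarrow> nat \<Rightarrow>\<^sub>0 real" where "\<And>j. P (z j)" "\<And>j. Poly_Mapping.keys (z j) \<subseteq> {m + j..}"
    "\<And>i j. i < j \<Longrightarrow> set_less (Poly_Mapping.keys (z i)) (Poly_Mapping.keys (z j))"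
proof -
  obtain g :: "nat \<Rightarrow> nat \<Rightarrow>\<^sub>0 real" where g: "\<And>v. Poly_Mapping.keys (g v) \<subseteq> {v..}" "\<And>v. P (g v)"
    using assms by metis
  \<comment> \<open>\<open>t j\<close> is where block \<open>j\<close> may start, one past
    everything used before. Inserting \<open>v\<close> keeps the maximum defined for an empty
    support and makes \<open>t\<close> strictly increasing.\<close>
  define t where "t = rec_nat m (\<lambda>_ v. Suc (Max (insert v (Poly_Mapping.keys (g v)))))"
  have t0: "t 0 = m" and tS: "t (Suc j) = Suc (Max (insert (t j) (Poly_Mapping.keys (g (t j)))))" for j
    by (simp_all add: t_def)
  have t_less: "k < t (Suc j)" if "k \<in> insert (t j) (Poly_Mapping.keys (g (t j)))" for k j
    unfolding tS less_Suc_eq_le using that by (intro Max_ge) auto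
  have t_mono: "t i \<le> t j" if "i \<le> j" for i j
    by (rule lift_Suc_mono_le[OF _ that]) (use t_less[OF insertI1] less_imp_le in blast)
  have t_ge: "m + j \<le> t j" for j
  proof (induction j)
    case (Suc j)
    then show ?case using t_less[of "t j" j] by simp
  qed (simp add: t0)
  show ?thesis
  proof (rule that[of "\<lambda>j. g (t j)"])
    show "P (g (t j))" for j by (rule g)
    show "Poly_Mapping.keys (g (t j)) \<subseteq> {m + j..}" for j using g(1)[of "t j"] t_ge[of j] by fastforce
    show "set_less (Poly_Mapping.keys (g (t i))) (Poly_Mapping.keys (g (t j)))" if "i < j" for i j
      unfolding set_less_def
    proof (intro ballI)
      fix k k' assume "k \<in> Poly_Mapping.keys (g (t i))" "k' \<in> Poly_Mapping.keys (g (t j))"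
      then have "k < t (Suc i)" "t j \<le> k'" using t_less g(1) by auto
      then show "k < k'" using t_mono[of "Suc i" j] that by simp
    qed
  qed
qed

lemma exists_fast_sequence:
  fixes G :: "nat \<Rightarrow> nat"
  obtains s :: "nat \<Rightarrow> nat" where "\<And>i. n \<le> s i" "\<And>i i'. i < i' \<Longrightarrow> G (s i) \<le> s i'"
proof -
  define s where "s = rec_nat n (\<lambda>_ v. v + G v)"
  have sS: "s (Suc i) = s i + G (s i)" for i by (simp add: s_def)
  have mono: "s i \<le> s i'" if "i \<le> i'" for i i'
    by (rule lift_Suc_mono_le[OF _ that]) (simp add: sS)
  show ?thesis
  proof (rule that[of s])
    show "n \<le> s i" for i using mono[of 0 i] by (simp add: s_def)
    show "G (s i) \<le> s i'" if "i < i'" for i i' using mono[of "Suc i" i'] that by (simp add: sS)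
  qed
qed


section \<open>The lower bound\<close>

lemma asymptotic_l1_with_sum_le:
  assumes "asymptotic_l1_with C x p" "1 \<le> n" "\<And>i. i \<in> {1..n} \<Longrightarrow> b i \<in> c00"
    and "admissible n (\<lambda>i. Poly_Mapping.keys (b i))"
  shows "(\<Sum>i=1..n. p (lincomb x (b i))) \<le> C * p (lincomb x (\<Sum>i=1..n. b i))"
proof -
  have C: "0 < C" using assms(1) by (simp add: asymptotic_l1_with_def)
  have "(1 / C) * (\<Sum>i=1..n. p (lincomb x (b i))) \<le> p (\<Sum>i=1..n. lincomb x (b i))"
    using assms unfolding asymptotic_l1_with_def by blast
  then show ?thesis using C by (simp add: linear_sum[OF linear_lincomb] divide_le_eq mult.commute)
qed

text \<open>The interval contains exactly \<open>s\<close> indices and its blocks start at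
  \<open>s\<close> or later, so shifting the index by \<open>s\<close> yields an admissible family
  of length \<open>s\<close>.\<close>

lemma asymptotic_l1_with_sum_interval_le:
  assumes "asymptotic_l1_with C x p" "1 \<le> s" "\<And>j. b j \<in> c00"
    and "\<And>j. s < j \<Longrightarrow> Poly_Mapping.keys (b j) \<subseteq> {s..}"
    and "\<And>i j. i < j \<Longrightarrow> set_less (Poly_Mapping.keys (b i)) (Poly_Mapping.keys (b j))"
  shows "(\<Sum>j\<in>{s<..2 * s}. p (lincomb x (b j))) \<le> C * p (lincomb x (\<Sum>j\<in>{s<..2 * s}. b j))"
proof -
  have shift: "(\<Sum>j\<in>{s<..2 * s}. f j) = (\<Sum>i=1..s. f (i + s))" for f :: "nat \<Rightarrow> 'c::comm_monoid_add"
  proof -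
    have "{s<..2 * s} = {1 + s..s + s}" by auto
    then show ?thesis by (simp only: sum.shift_bounds_cl_nat_ivl)
  qed
  have "admissible s (\<lambda>i. Poly_Mapping.keys (b (i + s)))"
    unfolding admissible_def
  proof (intro conjI ballI impI)
    show "s \<le> k" if "i \<in> {1..s}" "k \<in> Poly_Mapping.keys (b (i + s))" for i k
      using assms(4)[of "i + s"] that by auto
  qed (simp_all add: assms(5))
  then show ?thesis unfolding shift by (rule asymptotic_l1_with_sum_le[OF assms(1-3)])
qed

locale tsirelson_block =
  fixes e x :: "nat \<Rightarrow> 'a::banach" and p :: "'a \<Rightarrow> real"
    and N :: "(nat \<Rightarrow>\<^sub>0 real) \<Rightarrow> real" and u :: "nat \<Rightarrow> nat \<Rightarrow>\<^sub>0 real" and A B :: real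
  assumes N: "tsirelson_norm N" and compl: "is_completion N e"
    and u: "\<And>i. 1 \<le> i \<Longrightarrow> u i \<in> c00" "\<And>i. 1 \<le> i \<Longrightarrow> u i \<noteq> 0" "\<And>i. 1 \<le> i \<Longrightarrow> x i = lincomb e (u i)"
    and u_less: "\<And>i j. 1 \<le> i \<Longrightarrow> i < j \<Longrightarrow> set_less (Poly_Mapping.keys (u i)) (Poly_Mapping.keys (u j))"
    and p: "norm_on (closed_span x) p"
    and A: "0 < A" "\<And>v. v \<in> closed_span x \<Longrightarrow> A * norm v \<le> p v"
    and B: "0 < B" "\<And>v. v \<in> closed_span x \<Longrightarrow> p v \<le> B * norm v"
begin

text \<open>Both norms are pulled back to coefficients with respect to \<open>x\<close>:
  \<open>M\<close> is the Tsirelson norm and \<open>q\<close> the equivalent norm.\<close>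

abbreviation M :: "(nat \<Rightarrow>\<^sub>0 real) \<Rightarrow> real" where "M b \<equiv> N (lincomb u b)"

abbreviation q :: "(nat \<Rightarrow>\<^sub>0 real) \<Rightarrow> real" where "q b \<equiv> p (lincomb x b)"

lemma keys_pos: "b \<in> c00 \<Longrightarrow> i \<in> Poly_Mapping.keys b \<Longrightarrow> 1 \<le> i"
  by (cases i) (auto simp: c00_def)

lemma lincomb_u: "b \<in> c00 \<Longrightarrow> lincomb u b \<in> c00"
  using u(1) keys_pos by (intro lincomb_in_c00) blast

lemma norm_lincomb_x: "b \<in> c00 \<Longrightarrow> norm (lincomb x b) = M b"
proof -
  assume b: "b \<in> c00"
  then have "lincomb e (lincomb u b) = lincomb x b" using u(3) keys_pos by (intro lincomb_lincomb) blast
  then show ?thesis using compl lincomb_u[OF b] unfolding is_completion_def by metis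
qed

lemma q_bounds: "b \<in> c00 \<Longrightarrow> A * M b \<le> q b" "b \<in> c00 \<Longrightarrow> q b \<le> B * M b"
  using A(2) B(2) lincomb_in_closed_span norm_lincomb_x by fastforce+

lemma q_scaleR: "b \<in> c00 \<Longrightarrow> q (c *\<^sub>R b) = \<bar>c\<bar> * q b"
  by (simp add: linear_scale[OF linear_lincomb] norm_on_scaleR[OF p lincomb_in_closed_span])

lemma M_scaleR: "b \<in> c00 \<Longrightarrow> M (c *\<^sub>R b) = \<bar>c\<bar> * M b"
  by (simp add: linear_scale[OF linear_lincomb] norm_on_scaleR[OF tsirelson_norm_on[OF N] lincomb_u])

lemma M_nonneg: "b \<in> c00 \<Longrightarrow> 0 \<le> M b"
  by (rule norm_on_nonneg[OF tsirelson_norm_on[OF N] lincomb_u])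

lemma set_less_lincomb_u:
  assumes "b \<in> c00" "c \<in> c00" "set_less (Poly_Mapping.keys b) (Poly_Mapping.keys c)"
  shows "set_less (Poly_Mapping.keys (lincomb u b)) (Poly_Mapping.keys (lincomb u c))"
  unfolding set_less_def
proof (intro ballI)
  fix k k' assume "k \<in> Poly_Mapping.keys (lincomb u b)" "k' \<in> Poly_Mapping.keys (lincomb u c)"
  then obtain i j where "i \<in> Poly_Mapping.keys b" "k \<in> Poly_Mapping.keys (u i)"
      "j \<in> Poly_Mapping.keys c" "k' \<in> Poly_Mapping.keys (u j)"
    using keys_lincomb_subset by blast
  then show "k < k'"
    using assms(3) u_less[of i j] keys_pos[OF assms(1)] unfolding set_less_def by blast
qed

text \<open>Successive nonempty supports advance by at least one index per step. Hence families
  admissible with respect to \<open>x\<close> stay admissible with respect to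
  \<open>e\<close>.\<close>

lemma le_keys_u: "1 \<le> i \<Longrightarrow> k \<in> Poly_Mapping.keys (u i) \<Longrightarrow> i \<le> k"
proof (induction i arbitrary: k rule: dec_induct)
  case base
  then show ?case using keys_pos[OF u(1)] by auto
next
  case (step i)
  obtain k' where k': "k' \<in> Poly_Mapping.keys (u i)"
    using u(2)[of i] step.hyps by (metis equals0I keys_eq_empty)
  then have "k' < k" using u_less[of i "Suc i"] step unfolding set_less_def by auto
  then show ?case using step.IH[OF k'] by simp
qed

text \<open>The factor 2 is the constant of the Tsirelson norm on block vectors; replacing the norm
  by \<open>p\<close> costs \<open>B\<close> on the summands and \<open>1 / A\<close> on the sum.
  This also makes the set of constants nonempty, so that its infimum is meaningful.\<close>

lemma asymptotic_l1_with_ratio: "asymptotic_l1_with (2 * B / A) x p"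
  unfolding asymptotic_l1_with_def
proof (intro conjI allI impI)
  show "0 < 2 * B / A" using A(1) B(1) by simp
  fix n b assume n: "1 \<le> n"
    and "(\<forall>i\<in>{1..n}. b i \<in> c00) \<and> admissible n (\<lambda>i. Poly_Mapping.keys (b i))"
  then have b: "\<And>i. i \<in> {1..n} \<Longrightarrow> b i \<in> c00" and adm: "admissible n (\<lambda>i. Poly_Mapping.keys (b i))"
    by auto
  have sum_b: "(\<Sum>i=1..n. b i) \<in> c00" using b by (rule subspace_sum[OF subspace_c00])
  have ge: "n \<le> k" if i: "i \<in> {1..n}" and k: "k \<in> Poly_Mapping.keys (lincomb u (b i))" for i k
  proof -
    obtain j where j: "j \<in> Poly_Mapping.keys (b i)" "k \<in> Poly_Mapping.keys (u j)"
      using k keys_lincomb_subset by blast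
    have "n \<le> j" using adm i j(1) by (auto simp: admissible_def)
    then show ?thesis using le_keys_u[OF keys_pos[OF b[OF i] j(1)] j(2)] by simp
  qed
  have adm_u: "admissible n (\<lambda>i. Poly_Mapping.keys (lincomb u (b i)))"
    unfolding admissible_def
  proof (intro conjI ballI impI)
    show "set_less (Poly_Mapping.keys (lincomb u (b i))) (Poly_Mapping.keys (lincomb u (b j)))"
      if "i \<in> {1..n}" "j \<in> {1..n}" "i < j" for i j
      using adm that by (intro set_less_lincomb_u b) (auto simp: admissible_def)
  qed (use ge in auto)
  have "(\<Sum>i=1..n. q (b i)) \<le> (\<Sum>i=1..n. B * M (b i))"
    using q_bounds(2) b by (intro sum_mono) blast
  also have "\<dots> = 2 * B * ((1/2) * (\<Sum>i=1..n. M (b i)))" by (simp add: sum_distrib_left)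
  also have "\<dots> \<le> 2 * B * M (\<Sum>i=1..n. b i)"
    using tsirelson_block_sum_ge[OF N n lincomb_u[OF b] adm_u] B(1)
    by (intro mult_left_mono) (simp_all add: linear_sum[OF linear_lincomb])
  finally have "A * (\<Sum>i=1..n. q (b i)) \<le> 2 * B * (A * M (\<Sum>i=1..n. b i))"
    using A(1) by (simp add: mult.left_commute)
  also have "\<dots> \<le> 2 * B * q (\<Sum>i=1..n. b i)"
    using q_bounds(1)[OF sum_b] B(1) by simp
  finally show "1 / (2 * B / A) * (\<Sum>i=1..n. q (b i)) \<le> p (\<Sum>i=1..n. lincomb x (b i))"
    using B(1) by (simp add: linear_sum[OF linear_lincomb] divide_le_eq mult.commute)
qed

text \<open>Quantitative form for \<open>n\<close> averages: \<open>1 + 1 / n\<close> is the loss in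
  the choice of \<open>\<beta>\<close>, and \<open>1/2 + 3 / (2 * n)\<close> bounds the Tsirelson
  norm of the iterated average.\<close>

lemma asymptotic_l1_with_square_ge:
  fixes n :: nat
  assumes C: "asymptotic_l1_with C x p" and n: "1 \<le> n"
  shows "1 \<le> C\<^sup>2 * ((1 + 1 / n) * (1/2 + 3 / (2 * n)))"
proof -
  have C0: "0 < C" using C by (simp add: asymptotic_l1_with_def)
  define D where "D m = {b \<in> c00. Poly_Mapping.keys b \<subseteq> {m..}}" for m
  have D_c00: "b \<in> c00" if "b \<in> D m" for b m using that by (simp add: D_def)
  have D_ne: "\<exists>b\<in>D m. 0 < M b" for m
  proof (rule bexI)
    let ?b = "Poly_Mapping.single (Suc m) (1::real)"
    show b: "?b \<in> D m" by (simp add: D_def c00_def)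
    have "lincomb u ?b = u (Suc m)" by (simp add: lincomb_def)
    then have "M ?b \<noteq> 0"
      using tsirelson_norm_on[OF N] u(1,2)[of "Suc m"] by (simp add: norm_on_def)
    then show "0 < M ?b" using M_nonneg[OF D_c00[OF b]] by simp
  qed
  have "0 < 1 / real n" using n by simp
  then obtain \<beta> m0 where \<beta>: "0 < \<beta>"
    and upper: "\<And>b. b \<in> D m0 \<Longrightarrow> q b \<le> (1 + 1 / n) * \<beta> * M b"
    and ex: "\<And>m. \<exists>b\<in>D m. \<beta> * M b < q b"
    using near_maximal_ratio[where A = A and D = D and M = M and q = q and B = B and \<delta> = "1 / real n"]
      A(1) q_bounds D_c00 D_ne M_nonneg by metis
  have "\<exists>b. Poly_Mapping.keys b \<subseteq> {m..} \<and> (b \<in> c00 \<and> M b = 1 \<and> \<beta> \<le> q b)" for m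
  proof -
    obtain b where b: "b \<in> D m" "\<beta> * M b < q b" using ex by blast
    note bc = D_c00[OF b(1)]
    \<comment> \<open>If \<open>M b\<close> vanished, the upper equivalence bound would force
      \<open>q b\<close> to be at most 0, against the strict inequality for
      \<open>b\<close>.\<close>
    have "M b \<noteq> 0" using b(2) q_bounds(2)[OF bc] by auto
    then have M: "0 < M b" using M_nonneg[OF bc] by simp
    let ?b = "(1 / M b) *\<^sub>R b"
    have "Poly_Mapping.keys ?b \<subseteq> {m..}" using b(1) keys_scaleR_subset unfolding D_def by blast
    moreover have "?b \<in> c00" by (intro subspace_scale subspace_c00 bc)
    moreover have "M ?b = 1" using M by (simp add: M_scaleR[OF bc])
    moreover have "\<beta> \<le> q ?b" using M b(2) by (simp add: q_scaleR[OF bc] le_divide_eq)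
    ultimately show ?thesis by blast
  qed
  then obtain z where z: "\<And>j. z j \<in> c00 \<and> M (z j) = 1 \<and> \<beta> \<le> q (z j)"
    and z_ge: "\<And>j. Poly_Mapping.keys (z j) \<subseteq> {m0 + j..}"
    and z_less: "\<And>i j. i < j \<Longrightarrow> set_less (Poly_Mapping.keys (z i)) (Poly_Mapping.keys (z j))"
    by (rule exists_block_sequence[where m = m0 and P = "\<lambda>b. b \<in> c00 \<and> M b = 1 \<and> \<beta> \<le> q b"]) blast
  define a where "a j = lincomb u (z j)" for j
  \<comment> \<open>The last coordinate, with respect to \<open>e\<close>, reached by the blocks up
    to index \<open>v\<close>; inserting 0 guards against an empty set.\<close>
  define d where "d v = Max (insert 0 (\<Union>j\<le>v. Poly_Mapping.keys (a j)))" for v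
  have d: "k \<le> d v" if "j \<le> v" "k \<in> Poly_Mapping.keys (a j)" for j k v
    unfolding d_def using that by (intro Max_ge) auto
  \<comment> \<open>The start at \<open>n\<close> makes the outer family admissible. In the growth
    condition, \<open>2 * s i\<close> separates the index intervals, and
    \<open>n * d (2 * s i)\<close> makes later averages long compared with the supports of earlier
    ones.\<close>
  obtain s :: "nat \<Rightarrow> nat" where s_ge: "\<And>i. n \<le> s i"
    and s_fast: "\<And>i i'. i < i' \<Longrightarrow> 2 * s i + n * d (2 * s i) \<le> s i'"
    by (rule exists_fast_sequence[where G = "\<lambda>v. 2 * v + n * d (2 * v)" and n = n]) blast
  have s_pos: "1 \<le> s i" for i using n s_ge[of i] by simp
  \<comment> \<open>The weight combines the outer factor \<open>1 / n\<close> with the inner factor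
    \<open>1 / s i\<close>.\<close>
  define w where "w i j = (1 / (n * s i)) *\<^sub>R z j" for i j
  define Y where "Y i = (\<Sum>j\<in>{s i<..2 * s i}. w i j)" for i
  have w: "w i j \<in> c00" for i j unfolding w_def using z by (intro subspace_scale subspace_c00) blast
  have w_keys: "Poly_Mapping.keys (w i j) \<subseteq> Poly_Mapping.keys (z j)" for i j
    unfolding w_def by (rule keys_scaleR_subset)
  have Y: "Y i \<in> c00" for i unfolding Y_def by (intro subspace_sum subspace_c00 w)
  have Y_keys: "\<exists>j. s i < j \<and> j \<le> 2 * s i \<and> k \<in> Poly_Mapping.keys (z j)"
    if k: "k \<in> Poly_Mapping.keys (Y i)" for i k
  proof -
    have "k \<in> (\<Union>j\<in>{s i<..2 * s i}. Poly_Mapping.keys (w i j))"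
      using k keys_sum_subset unfolding Y_def by blast
    then obtain j where j: "j \<in> {s i<..2 * s i}" "k \<in> Poly_Mapping.keys (w i j)" by blast
    then show ?thesis using subsetD[OF w_keys j(2)] by (intro exI[of _ j]) simp
  qed
  have Y_ge: "n \<le> k" "m0 \<le> k" if k: "k \<in> Poly_Mapping.keys (Y i)" for i k
  proof -
    obtain j where "s i < j" "k \<in> Poly_Mapping.keys (z j)" using Y_keys[OF k] by blast
    then show "n \<le> k" "m0 \<le> k" using z_ge[of j] s_ge[of i] by auto
  qed
  have Y_less: "set_less (Poly_Mapping.keys (Y i)) (Poly_Mapping.keys (Y i'))" if "i < i'" for i i'
    unfolding set_less_def
  proof (intro ballI)
    fix k k' assume "k \<in> Poly_Mapping.keys (Y i)" "k' \<in> Poly_Mapping.keys (Y i')"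
    then obtain j j' where j: "j \<le> 2 * s i" "k \<in> Poly_Mapping.keys (z j)"
      and j': "s i' < j'" "k' \<in> Poly_Mapping.keys (z j')"
      using Y_keys by blast
    then have "j < j'" using s_fast[OF that] by linarith
    then show "k < k'" using z_less j(2) j'(2) unfolding set_less_def by blast
  qed
  \<comment> \<open>Inner layer: each \<open>Y i\<close> sums \<open>s i\<close> vectors, each of
    \<open>q\<close> value at least \<open>\<beta> / (n * s i)\<close>, and the lower l1 estimate
    costs one factor \<open>C\<close>.\<close>
  have "\<beta> / n \<le> C * q (Y i)" for i
  proof -
    have "\<beta> / n = (\<Sum>j\<in>{s i<..2 * s i}. (1 / (n * s i)) * \<beta>)" using s_pos[of i] by simp
    also have "\<dots> \<le> (\<Sum>j\<in>{s i<..2 * s i}. q (w i j))"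
    proof (rule sum_mono)
      fix j
      show "(1 / (n * s i)) * \<beta> \<le> q (w i j)"
        using z[of j] by (simp add: w_def q_scaleR divide_right_mono)
    qed
    also have "\<dots> \<le> C * q (Y i)"
      unfolding Y_def
    proof (rule asymptotic_l1_with_sum_interval_le[OF C s_pos w])
      show "Poly_Mapping.keys (w i j) \<subseteq> {s i..}" if "s i < j" for j
        using w_keys[of i j] z_ge[of j] that by fastforce
      show "set_less (Poly_Mapping.keys (w i j)) (Poly_Mapping.keys (w i j'))" if "j < j'" for j j'
        using z_less[OF that] w_keys unfolding set_less_def by blast
    qed
    finally show ?thesis .
  qed
  then have "(\<Sum>i=1..n. \<beta> / n) \<le> (\<Sum>i=1..n. C * q (Y i))" by (rule sum_mono)
  then have "\<beta> \<le> C * (\<Sum>i=1..n. q (Y i))" using n by (simp add: sum_distrib_left)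
  \<comment> \<open>Outer layer: the \<open>n\<close> vectors \<open>Y i\<close> are successive and
    supported beyond \<open>n\<close>, which costs the second factor \<open>C\<close>.\<close>
  also have "\<dots> \<le> C * (C * q (\<Sum>i=1..n. Y i))"
  proof (rule mult_left_mono[OF asymptotic_l1_with_sum_le[OF C n Y]])
    show "admissible n (\<lambda>i. Poly_Mapping.keys (Y i))"
      using Y_ge(1) Y_less by (auto simp: admissible_def)
  qed (use C0 in simp)
  \<comment> \<open>The whole sum is supported beyond \<open>m0\<close>, so the near-maximality of
    \<open>\<beta>\<close> turns the Tsirelson estimate into an upper bound for
    \<open>q\<close>.\<close>
  also have "\<dots> \<le> C * (C * ((1 + 1 / n) * \<beta> * (1/2 + 3 / (2 * n))))"
  proof -
    have "(\<Sum>i=1..n. Y i) \<in> c00" by (rule subspace_sum[OF subspace_c00 Y])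
    then have "(\<Sum>i=1..n. Y i) \<in> D m0"
      using Y_ge(2) keys_sum_subset[of Y "{1..n}"] unfolding D_def by auto
    then have "q (\<Sum>i=1..n. Y i) \<le> (1 + 1 / n) * \<beta> * M (\<Sum>i=1..n. Y i)" by (rule upper)
    also have "\<dots> \<le> (1 + 1 / n) * \<beta> * (1/2 + 3 / (2 * n))"
    proof (rule mult_left_mono)
      have "lincomb u (\<Sum>i=1..n. Y i) = (\<Sum>i=1..n. (1 / (n * s i)) *\<^sub>R (\<Sum>j\<in>{s i<..2 * s i}. a j))"
        by (simp add: Y_def w_def a_def linear_sum[OF linear_lincomb] linear_scale[OF linear_lincomb]
            scaleR_sum_right)
      moreover have "N (\<Sum>i=1..n. (1 / (n * s i)) *\<^sub>R (\<Sum>j\<in>{s i<..2 * s i}. a j)) \<le> 1/2 + 3 / (2 * n)"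
      proof (rule tsirelson_iterated_average_le[OF N n])
        show "a j \<in> c00" "N (a j) \<le> 1" for j using z[of j] by (simp_all add: a_def lincomb_u)
        show "set_less (Poly_Mapping.keys (a i)) (Poly_Mapping.keys (a j))" if "i < j" for i j
          unfolding a_def using z z_less[OF that] by (intro set_less_lincomb_u) auto
        show "1 \<le> s i" for i by (rule s_pos)
        show "2 * s i \<le> s i'" if "i < i'" for i i' using s_fast[OF that] by simp
        show "n * k \<le> s i'" if "i < i'" "j \<le> 2 * s i" "k \<in> Poly_Mapping.keys (a j)" for i i' j k
          using s_fast[OF that(1)] mult_le_mono2[OF d[OF that(2,3)], of n] by linarith
      qed
      ultimately show "M (\<Sum>i=1..n. Y i) \<le> 1/2 + 3 / (2 * n)" by simp
    qed (use \<beta> in simp)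
    finally show ?thesis using C0 by (intro mult_left_mono) auto
  qed
  finally have "1 * \<beta> \<le> (C\<^sup>2 * ((1 + 1 / n) * (1/2 + 3 / (2 * n)))) * \<beta>"
    by (simp add: power2_eq_square ac_simps)
  then show ?thesis using \<beta> by (rule mult_right_le_imp_le)
qed

lemma asymptotic_l1_with_ge_sqrt_2:
  assumes C: "asymptotic_l1_with C x p"
  shows "sqrt 2 \<le> C"
proof -
  \<comment> \<open>Writing 3/(2n) as a multiple of \<open>1 / real n\<close> lets the limit be read
    off factor by factor; the limiting inequality says that \<open>C\<^sup>2 / 2\<close> is at least
    1.\<close>
  have "(\<lambda>n. C\<^sup>2 * ((1 + 1 / real n) * (1/2 + (3/2) * (1 / real n)))) \<longlonglongrightarrow> C\<^sup>2 * ((1 + 0) * (1/2 + (3/2) * 0))"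
    by (intro tendsto_intros lim_1_over_n)
  moreover have "\<exists>k. \<forall>n\<ge>k. 1 \<le> C\<^sup>2 * ((1 + 1 / real n) * (1/2 + (3/2) * (1 / real n)))"
    using asymptotic_l1_with_square_ge[OF C] by (intro exI[of _ 1]) simp
  ultimately have "1 \<le> C\<^sup>2 * ((1 + 0) * (1/2 + (3/2) * 0))"
    by (rule LIMSEQ_le_const)
  then have "2 \<le> C\<^sup>2" by simp
  moreover have "0 < C" using C by (simp add: asymptotic_l1_with_def)
  ultimately show ?thesis by (intro real_le_lsqrt) auto
qed

end

theorem proposition2p8:
  fixes e x :: "nat \<Rightarrow> 'a::banach" and p :: "'a \<Rightarrow> real"
  assumes T: "tsirelson_space e"
    and X: "block_basis e x"
    and p: "equivalent_norm_on (closed_span x) p"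
  shows "asymptotic_l1 x p \<and> sqrt 2 \<le> asymptotic_l1_constant x p"
proof -
  obtain N where N: "tsirelson_norm N" "is_completion N e"
    using T unfolding tsirelson_space_def by blast
  obtain u where u: "\<forall>i\<ge>1. u i \<in> c00 \<and> u i \<noteq> 0 \<and> x i = lincomb e (u i)"
    "\<forall>i\<ge>1. \<forall>j>i. set_less (Poly_Mapping.keys (u i)) (Poly_Mapping.keys (u j))"
    using X unfolding block_basis_def by blast
  obtain A B where AB: "norm_on (closed_span x) p" "0 < A" "0 < B"
    "\<forall>v\<in>closed_span x. A * norm v \<le> p v \<and> p v \<le> B * norm v"
    using p unfolding equivalent_norm_on_def by blast
  interpret tsirelson_block e x p N u A B
    by unfold_locales (use N u AB in auto)
  have "sqrt 2 \<le> Inf {C. asymptotic_l1_with C x p}"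
    using asymptotic_l1_with_ratio asymptotic_l1_with_ge_sqrt_2 by (intro cInf_greatest) auto
  then show ?thesis
    using asymptotic_l1_with_ratio unfolding asymptotic_l1_def asymptotic_l1_constant_def by blast
qed

end
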